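(* Let $V$ be an irreducible integrable module over $\widetilde{LT}$ on which $K_1,\dots,K_n$ act trivially. Then $\mathcal Z(\underline m)$ acts trivially on $V$.
   Context: Everything is over $\mathbb C$. **The Lie torus.** $\mathfrak g$ is a finite-dimensional simple Lie algebra with a symmetric non-degenerate invariant bilinear form $(\cdot|\cdot)$, invariant under all automorphisms of $\mathfrak g$. $n\in\mathbb N$, $A=\mathbb C[t_1^{\pm1},\dots,t_n^{\pm1}]$, $t^{\underline k}=t_1^{k_1}\cdots t_n^{k_n}$ and $x(\underline k)=x\otimes t^{\underline k}$ for $\underline k\in\mathbb Z^n$. $\sigma_1,\dots,\sigma_n$ are commuting automorphisms of $\mathfrak g$ of finite orders $m_1,\dots,m_n$; $\xi_i$ is a primitive $m_i$-th root of unity; $\Gamma=m_1\mathbb Z\oplus\cdots\oplus m_n\mathbb Z$; $\overline k$ is the class of $\underline k$ in $\mathbb Z^n/\Gamma$; $\mathfrak g_{\overline k}=\{x\in\mathfrak g:\sigma_ix=\xi_i^{k_i}x,\ 1\le i\le n\}$. $LT=\bigoplus_{\underline k\in\mathbb Z^n}\mathfrak g_{\overline k}\otimes\mathbb Ct^{\underline k}$ with bracket $[x\otimes f,y\otimes g]=[x,y]\otimes fg$. Standing assumption: $LT$ is a Lie torus, i.e. (1) $\mathfrak g_{\overline 0}$ is a finite-dimensional simple Lie algebra (with Cartan subalgebra $\mathfrak h_{\overline0}$); (2) for $\overline k\ne\overline0$ with $\mathfrak g_{\overline k}\neq0$, as $\mathfrak g_{\overline0}$-module $\mathfrak g_{\overline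 k}\cong U_{\overline k}\oplus W_{\overline k}$ with $U_{\overline k}$ trivial and $W_{\overline k}$ either zero or irreducible of dimension $>1$ with all $\mathfrak h_{\overline0}$-weights in $\Delta_{0,\mathrm{en}}$; (3) $|\langle\sigma_1,\dots,\sigma_n\rangle|=\prod_i m_i$. Here $\Delta_0^\times$ is the set of non-zero roots of $(\mathfrak g_{\overline0},\mathfrak h_{\overline0})$, $\Delta_{0,\mathrm{en}}^\times=\Delta_0^\times\cup2\Delta^\times_{0,\mathrm{sh}}$ ($\mathrm{sh}$ = short roots) if $\Delta_0^\times$ is of type $B_l$ ($l\ge1$, $B_1=A_1$), $\Delta_{0,\mathrm{en}}^\times=\Delta_0^\times$ otherwise, and $\Delta_{0,\mathrm{en}}=\Delta_{0,\mathrm{en}}^\times\cup\{0\}$. For $\alpha\in\mathfrak h_{\overline0}^*$, $\mathfrak g_{\overline k}(\alpha)=\{x\in\mathfrak g_{\overline k}:[h,x]=\alpha(h)x\ \forall h\in\mathfrak h_{\overline0}\}$. **The graded Lie torus.** $\mathcal Z(\underline m)$ is the space spanned by symbols $t^{\underline k}K_i$ ($\underline k\in\Gamma$, $1\le i\le n$) modulo the relations $\sum_ik_it^{\underline k}K_i=0$; $K_i=t^{\underline0}K_i$. $D$ has basis $d_1,\dots,d_n$. $\widetilde{LT}=LT\oplus\mathcal Z(\underline m)\oplus D$ with $[x(\underline k),y(\underline l)]=[x,y](\underline k+\underline l)+(x|y)\sum_ik_it^{\underline k+\underline l}K_i$, $\mathcal Z(\underline m)$ central in $LT\oplus\mathcal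 Z(\underline m)$, $[d_i,x(\underline k)]=k_ix(\underline k)$, $[d_i,t^{\underline k}K_j]=k_it^{\underline k}K_j$, $[d_i,d_j]=0$. $\widetilde{\mathfrak h}=\mathfrak h_{\overline0}\oplus\sum_i\mathbb CK_i\oplus\sum_i\mathbb Cd_i$. **Integrable.** An $\widetilde{LT}$-module $V$ is integrable if it is the direct sum of its weight spaces $V_\lambda$ ($\lambda\in\widetilde{\mathfrak h}^*$), all $V_\lambda$ are finite-dimensional, and every element of $\mathfrak g_{\overline k}(\alpha)\otimes\mathbb Ct^{\underline k}$ with $\alpha\neq0$ acts locally nilpotently on $V$. *)

theory Defs
  imports
    "HOL-Analysis.Cartesian_Space"
    "HOL-Analysis.Product_Vector"
    "HOL-Library.Poly_Mapping"
    "HOL-Algebra.Bij"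
    "HOL-Algebra.Generated_Groups"
begin

section \<open>Linear algebra and Lie algebras over a field of scalars\<close>

context vector_space
begin

definition fin_dim :: "'b set \<Rightarrow> bool" where
  "fin_dim S \<longleftrightarrow> (\<exists>B. finite B \<and> S = span B)"

text \<open>The dual space of a subspace \<open>S\<close>. A functional is extended by \<open>0\<close> outside \<open>S\<close>, so that
  functions that agree on \<open>S\<close> are equal and the vector space operations are pointwise.\<close>

definition dual :: "'b set \<Rightarrow> ('b \<Rightarrow> 'a) set" where
  "dual S = {\<mu>. (\<forall>x\<in>S. \<forall>y\<in>S. \<mu> (x + y) = \<mu> x + \<mu> y) \<and>
                (\<forall>c. \<forall>x\<in>S. \<mu> (c *s x) = c * \<mu> x) \<and>
                (\<forall>x. x \<notin> S \<longrightarrow> \<mu> x = 0)}"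

definition direct_sum_of :: "'i set \<Rightarrow> ('i \<Rightarrow> 'b set) \<Rightarrow> 'b set \<Rightarrow> bool" where
  "direct_sum_of I U S \<longleftrightarrow> (\<forall>i\<in>I. subspace (U i) \<and> U i \<subseteq> S) \<and>
     (\<forall>v\<in>S. \<exists>!f :: 'i \<Rightarrow>\<^sub>0 'b. Poly_Mapping.keys f \<subseteq> I \<and>
        (\<forall>i\<in>I. Poly_Mapping.lookup f i \<in> U i) \<and>
        v = (\<Sum>i\<in>Poly_Mapping.keys f. Poly_Mapping.lookup f i))"

text \<open>In the next definition \<open>L\<close> is a set acting on the ambient space by \<open>\<rho>\<close>, and \<open>U\<close> is an
  \<open>L\<close>-submodule.\<close>

definition irreducible_under :: "'l set \<Rightarrow> ('l \<Rightarrow> 'b \<Rightarrow> 'b) \<Rightarrow> 'b set \<Rightarrow> bool" where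
  "irreducible_under L \<rho> U \<longleftrightarrow> U \<noteq> {0} \<and>
     (\<forall>W. subspace W \<and> W \<subseteq> U \<and> (\<forall>X\<in>L. \<forall>w\<in>W. \<rho> X w \<in> W) \<longrightarrow> W = {0} \<or> W = U)"

end

definition lie_module ::
  "'l::ab_group_add set \<Rightarrow> ('k::field \<Rightarrow> 'l \<Rightarrow> 'l) \<Rightarrow> ('l \<Rightarrow> 'l \<Rightarrow> 'l) \<Rightarrow>
   ('k \<Rightarrow> 'v::ab_group_add \<Rightarrow> 'v) \<Rightarrow> ('l \<Rightarrow> 'v \<Rightarrow> 'v) \<Rightarrow> bool" where
  "lie_module L scaleL bracketL scaleV \<rho> \<longleftrightarrow>
     vector_space scaleV \<and>
     (\<forall>X\<in>L. Vector_Spaces.linear scaleV scaleV (\<rho> X)) \<and>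
     (\<forall>X\<in>L. \<forall>Y\<in>L. \<forall>v. \<rho> (X + Y) v = \<rho> X v + \<rho> Y v) \<and>
     (\<forall>c. \<forall>X\<in>L. \<forall>v. \<rho> (scaleL c X) v = scaleV c (\<rho> X v)) \<and>
     (\<forall>X\<in>L. \<forall>Y\<in>L. \<forall>v. \<rho> (bracketL X Y) v = \<rho> X (\<rho> Y v) - \<rho> Y (\<rho> X v))"

locale lie_algebra = vector_space scale
  for scale :: "'k::field \<Rightarrow> 'g::ab_group_add \<Rightarrow> 'g" +
  fixes bracket :: "'g \<Rightarrow> 'g \<Rightarrow> 'g"
  assumes bracket_add_left: "bracket (x + y) z = bracket x z + bracket y z"
    and bracket_add_right: "bracket x (y + z) = bracket x y + bracket x z"
    and bracket_scale_left: "bracket (scale c x) y = scale c (bracket x y)"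
    and bracket_scale_right: "bracket x (scale c y) = scale c (bracket x y)"
    and bracket_self: "bracket x x = 0"
    and jacobi: "bracket x (bracket y z) + bracket y (bracket z x) + bracket z (bracket x y) = 0"
begin

definition subalgebra :: "'g set \<Rightarrow> bool" where
  "subalgebra S \<longleftrightarrow> subspace S \<and> (\<forall>x\<in>S. \<forall>y\<in>S. bracket x y \<in> S)"

definition ideal_of :: "'g set \<Rightarrow> 'g set \<Rightarrow> bool" where
  "ideal_of I S \<longleftrightarrow> subspace I \<and> I \<subseteq> S \<and> (\<forall>x\<in>S. \<forall>y\<in>I. bracket x y \<in> I)"

definition simple :: "'g set \<Rightarrow> bool" where
  "simple S \<longleftrightarrow> subalgebra S \<and> (\<exists>x\<in>S. \<exists>y\<in>S. bracket x y \<noteq> 0) \<and>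
     (\<forall>I. ideal_of I S \<longrightarrow> I = {0} \<or> I = S)"

fun lower_central :: "'g set \<Rightarrow> nat \<Rightarrow> 'g set" where
  "lower_central S 0 = S"
| "lower_central S (Suc i) = span {bracket x y | x y. x \<in> S \<and> y \<in> lower_central S i}"

definition nilpotent :: "'g set \<Rightarrow> bool" where
  "nilpotent S \<longleftrightarrow> subalgebra S \<and> (\<exists>i. lower_central S i = {0})"

definition cartan_subalgebra :: "'g set \<Rightarrow> 'g set \<Rightarrow> bool" where
  "cartan_subalgebra H S \<longleftrightarrow> H \<subseteq> S \<and> nilpotent H \<and>
     {x\<in>S. \<forall>h\<in>H. bracket x h \<in> H} = H"

definition automorphism :: "('g \<Rightarrow> 'g) \<Rightarrow> bool" where
  "automorphism \<phi> \<longleftrightarrow> Vector_Spaces.linear scale scale \<phi> \<and> bij \<phi> \<and>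
     (\<forall>x y. \<phi> (bracket x y) = bracket (\<phi> x) (\<phi> y))"

end


section \<open>Root systems of type \<open>B\<close>\<close>

text \<open>\<open>R\<close> is, in suitable linearly independent coordinates, the root system
  \<open>{\<plusminus>\<epsilon>\<^sub>i} \<union> {\<plusminus>\<epsilon>\<^sub>i \<plusminus> \<epsilon>\<^sub>j | i < j}\<close> of type \<open>B\<^sub>l\<close>; for \<open>l = 1\<close> this is \<open>A\<^sub>1\<close>.\<close>

definition type_B :: "nat \<Rightarrow> ('g \<Rightarrow> 'k::field) set \<Rightarrow> bool" where
  "type_B l R \<longleftrightarrow> (\<exists>\<epsilon> :: nat \<Rightarrow> 'g \<Rightarrow> 'k.
     (\<forall>c. (\<forall>x. (\<Sum>i<l. c i * \<epsilon> i x) = 0) \<longrightarrow> (\<forall>i<l. c i = 0)) \<and>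
     R = {\<lambda>x. s * \<epsilon> i x | s i. i < l \<and> s \<in> {1, -1}} \<union>
         {\<lambda>x. s * \<epsilon> i x + t * \<epsilon> j x | s t i j. i < j \<and> j < l \<and> s \<in> {1, -1} \<and> t \<in> {1, -1}})"


section \<open>The symbols \<open>t\<^sup>k K\<^sub>i\<close> modulo relations\<close>

text \<open>The free complex vector space on the symbols \<open>t\<^sup>k K\<^sub>i\<close> consists of the finitely supported
  functions on \<open>\<int>\<^sup>n \<times> {1..n}\<close>. Since a type cannot depend on \<open>m\<close>, all \<open>k \<in> \<int>\<^sup>n\<close> are allowed here
  and in the relations. The space \<open>\<Z>(m)\<close> is the span of the symbols with \<open>k \<in> \<Gamma>\<close>, defined below;
  lemma \<open>symbol_combination_eq_0_iff\<close> shows that the only relations between these are the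
  combinations of the defining relations with \<open>k \<in> \<Gamma>\<close>, because the relations are homogeneous.\<close>

definition fscale :: "complex \<Rightarrow> ('i \<Rightarrow>\<^sub>0 complex) \<Rightarrow> ('i \<Rightarrow>\<^sub>0 complex)" where
  "fscale c = Poly_Mapping.map ((*) c)"

lemma lookup_fscale [simp]:
  "Poly_Mapping.lookup (fscale c f) i = c * Poly_Mapping.lookup f i"
  by (auto simp: fscale_def Poly_Mapping.map.rep_eq when_def)

interpretation fs: vector_space fscale
  by unfold_locales
    (auto intro!: poly_mapping_eqI simp: lookup_add algebra_simps)

definition symbol_relation :: "int^'n \<Rightarrow> ((int^'n) \<times> 'n) \<Rightarrow>\<^sub>0 complex" where
  "symbol_relation k = (\<Sum>i\<in>UNIV. Poly_Mapping.single (k, i) (of_int (k $ i)))"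

definition symbol_relations :: "(((int^'n) \<times> 'n) \<Rightarrow>\<^sub>0 complex) set" where
  "symbol_relations = fs.span (range symbol_relation)"

quotient_type (overloaded) 'n symbol_space = "((int^('n::finite)) \<times> 'n) \<Rightarrow>\<^sub>0 complex" /
  "\<lambda>a b. a - b \<in> symbol_relations"
proof (rule equivpI)
  show "reflp (\<lambda>a b. a - b \<in> symbol_relations)"
    by (simp add: reflp_def symbol_relations_def fs.span_zero)
  show "symp (\<lambda>a b. a - b \<in> symbol_relations)"
    using fs.span_neg by (fastforce simp: symp_def symbol_relations_def)
  show "transp (\<lambda>a b. a - b \<in> symbol_relations)"
    using fs.span_add by (fastforce simp: transp_def symbol_relations_def)
qed

instantiation symbol_space :: (finite) ab_group_add
begin

lift_definition zero_symbol_space :: "'a symbol_space" is 0 .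

lift_definition plus_symbol_space :: "'a symbol_space \<Rightarrow> 'a symbol_space \<Rightarrow> 'a symbol_space"
  is "(+)"
  unfolding symbol_relations_def by (subst add_diff_add) (rule fs.span_add)

lift_definition minus_symbol_space :: "'a symbol_space \<Rightarrow> 'a symbol_space \<Rightarrow> 'a symbol_space"
  is "(-)"
proof -
  fix a b c d :: "((int^'a) \<times> 'a) \<Rightarrow>\<^sub>0 complex"
  assume "a - b \<in> symbol_relations" "c - d \<in> symbol_relations"
  then have "(a - b) - (c - d) \<in> symbol_relations"
    unfolding symbol_relations_def by (rule fs.span_diff)
  then show "(a - c) - (b - d) \<in> symbol_relations"
    by (simp add: algebra_simps)
qed

lift_definition uminus_symbol_space :: "'a symbol_space \<Rightarrow> 'a symbol_space" is uminus
  unfolding symbol_relations_def by (subst minus_diff_minus) (rule fs.span_neg)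

instance
  by standard (transfer, simp add: symbol_relations_def fs.span_zero algebra_simps)+

end

lift_definition sscale :: "complex \<Rightarrow> ('n::finite) symbol_space \<Rightarrow> 'n symbol_space" is fscale
  unfolding symbol_relations_def by (subst fs.scale_right_diff_distrib[symmetric]) (rule fs.span_scale)

interpretation ss: vector_space sscale
  by unfold_locales
    (transfer, simp add: symbol_relations_def fs.span_zero fs.scale_right_distrib
      fs.scale_left_distrib)+

lift_definition tK :: "int^('n::finite) \<Rightarrow> 'n \<Rightarrow> 'n symbol_space" is
  "\<lambda>k i. Poly_Mapping.single (k, i) 1" .

definition pairing :: "complex^('n::finite) \<Rightarrow> int^'n \<Rightarrow> complex" where
  "pairing d k = (\<Sum>i\<in>UNIV. d $ i * of_int (k $ i))"

text \<open>For \<open>d = \<Sum>\<^sub>i c\<^sub>i d\<^sub>i\<close>, the derivation \<open>t\<^sup>k K\<^sub>j \<mapsto> (\<Sum>\<^sub>i c\<^sub>i k\<^sub>i) t\<^sup>k K\<^sub>j\<close>.\<close>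

definition fdegree :: "complex^('n::finite) \<Rightarrow>
    ((int^'n) \<times> 'n \<Rightarrow>\<^sub>0 complex) \<Rightarrow> ((int^'n) \<times> 'n \<Rightarrow>\<^sub>0 complex)" where
  "fdegree d = Poly_Mapping.mapp (\<lambda>(k, j) c. pairing d k * c)"

lemma lookup_fdegree [simp]:
  "Poly_Mapping.lookup (fdegree d f) p = pairing d (fst p) * Poly_Mapping.lookup f p"
  by (auto simp: fdegree_def lookup_mapp when_def in_keys_iff split: prod.splits)

lemma fdegree_relations:
  assumes "f \<in> symbol_relations"
  shows "fdegree d f \<in> symbol_relations"
  using assms unfolding symbol_relations_def
proof (induction rule: fs.span_induct_alt)
  case base
  have "fdegree d 0 = 0"
    by (rule poly_mapping_eqI) simp
  then show ?case by (simp add: fs.span_zero)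
next
  case (step c x y)
  then obtain k where k: "x = symbol_relation k" by blast
  have "fdegree d (fscale c x + y) = fscale (pairing d k * c) x + fdegree d y"
    by (rule poly_mapping_eqI)
      (auto simp: k symbol_relation_def lookup_add lookup_sum lookup_single when_def
        algebra_simps intro!: sum.neutral)
  then show ?case
    using step k by (metis fs.span_add fs.span_base fs.span_scale rangeI)
qed

lift_definition sdegree :: "complex^('n::finite) \<Rightarrow> 'n symbol_space \<Rightarrow> 'n symbol_space" is fdegree
proof -
  fix d :: "complex^'n" and a b :: "((int^'n) \<times> 'n) \<Rightarrow>\<^sub>0 complex"
  assume "a - b \<in> symbol_relations"
  moreover have "fdegree d a - fdegree d b = fdegree d (a - b)"
    by (rule poly_mapping_eqI) (simp add: lookup_minus algebra_simps)
  ultimately show "fdegree d a - fdegree d b \<in> symbol_relations"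
    by (simp add: fdegree_relations)
qed

lemma abs_symbol_eq_0_iff: "abs_symbol_space f = 0 \<longleftrightarrow> f \<in> symbol_relations"
  by (simp add: zero_symbol_space_def symbol_space.abs_eq_iff)

lemma symbol_combination_eq_0_iff:
  fixes \<Gamma> :: "(int^('n::finite)) set"
  assumes "Poly_Mapping.keys f \<subseteq> \<Gamma> \<times> UNIV"
  shows "abs_symbol_space f = 0 \<longleftrightarrow> f \<in> fs.span (symbol_relation ` \<Gamma>)"
proof -
  define R where "R = (\<lambda>f :: ((int^'n) \<times> 'n) \<Rightarrow>\<^sub>0 complex.
    Poly_Mapping.mapp (\<lambda>(k, j) c. if k \<in> \<Gamma> then c else 0) f)"
  have lR: "Poly_Mapping.lookup (R g) p = (if fst p \<in> \<Gamma> then Poly_Mapping.lookup g p else 0)"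
    for g p
    by (auto simp: R_def lookup_mapp when_def in_keys_iff split: prod.splits)
  have *: "R g \<in> fs.span (symbol_relation ` \<Gamma>)" if "g \<in> symbol_relations" for g
    using that unfolding symbol_relations_def
  proof (induction rule: fs.span_induct_alt)
    case base
    have "R 0 = 0" by (rule poly_mapping_eqI) (simp add: lR)
    then show ?case by (simp add: fs.span_zero)
  next
    case (step c x y)
    then obtain k where k: "x = symbol_relation k" by blast
    have "R (fscale c x + y) = (if k \<in> \<Gamma> then fscale c x else 0) + R y"
      by (rule poly_mapping_eqI)
        (auto simp: k lR symbol_relation_def lookup_add lookup_sum lookup_single when_def
          intro!: sum.neutral)
    then show ?case
      using step k by (auto intro!: fs.span_add fs.span_scale fs.span_zero intro: fs.span_base)
  qed
  have "R f = f"
    using assms by (intro poly_mapping_eqI) (auto simp: lR in_keys_iff subset_iff)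
  moreover have "fs.span (symbol_relation ` \<Gamma>) \<subseteq> symbol_relations"
    unfolding symbol_relations_def by (rule fs.span_mono) auto
  ultimately show ?thesis
    unfolding abs_symbol_eq_0_iff using *[of f] by (auto simp: subset_iff)
qed


section \<open>Lie tori\<close>

text \<open>The type \<open>'n\<close> is the index set \<open>{1, \<dots>, n}\<close>, and all of the type \<open>'g\<close> is the Lie algebra
  \<open>\<gg>\<close>.\<close>

locale multiloop = lie_algebra scale bracket
  for scale :: "complex \<Rightarrow> 'g::ab_group_add \<Rightarrow> 'g" and bracket :: "'g \<Rightarrow> 'g \<Rightarrow> 'g" +
  fixes form :: "'g \<Rightarrow> 'g \<Rightarrow> complex"
    and \<sigma> :: "'n::finite \<Rightarrow> 'g \<Rightarrow> 'g"
    and m :: "'n \<Rightarrow> nat"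
    and \<xi> :: "'n \<Rightarrow> complex"
  assumes fin_dim_UNIV: "fin_dim UNIV"
    and simple_UNIV: "simple UNIV"
    and form_add: "form (x + y) z = form x z + form y z"
    and form_scale: "form (scale c x) y = c * form x y"
    and form_sym: "form x y = form y x"
    and form_nondegenerate: "(\<And>y. form x y = 0) \<Longrightarrow> x = 0"
    and form_invariant: "form (bracket x y) z = form x (bracket y z)"
    and form_automorphism: "automorphism \<phi> \<Longrightarrow> form (\<phi> x) (\<phi> y) = form x y"
    and \<sigma>_automorphism: "automorphism (\<sigma> i)"
    and \<sigma>_commute: "\<sigma> i \<circ> \<sigma> j = \<sigma> j \<circ> \<sigma> i"
    and \<sigma>_order: "m i > 0" "\<sigma> i ^^ m i = id" "0 < p \<Longrightarrow> p < m i \<Longrightarrow> \<sigma> i ^^ p \<noteq> id"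
    and \<xi>_primitive: "\<xi> i ^ m i = 1" "0 < p \<Longrightarrow> p < m i \<Longrightarrow> \<xi> i ^ p \<noteq> 1"
begin

definition \<Gamma> :: "(int^'n) set" where
  "\<Gamma> = {k. \<forall>i. int (m i) dvd k $ i}"

text \<open>\<open>grade k\<close> is \<open>\<gg>\<close> at the class of \<open>k\<close>, which depends on \<open>k\<close> only modulo \<open>\<Gamma>\<close>.\<close>

definition grade :: "int^'n \<Rightarrow> 'g set" where
  "grade k = {x. \<forall>i. \<sigma> i x = scale (\<xi> i powi (k $ i)) x}"

definition grade_weight :: "'g set \<Rightarrow> int^'n \<Rightarrow> ('g \<Rightarrow> complex) \<Rightarrow> 'g set" where
  "grade_weight H k \<alpha> = {x \<in> grade k. \<forall>h\<in>H. bracket h x = scale (\<alpha> h) x}"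

definition nonzero_roots :: "'g set \<Rightarrow> ('g \<Rightarrow> complex) set" where
  "nonzero_roots H = {\<alpha> \<in> dual H. \<alpha> \<noteq> (\<lambda>_. 0) \<and> grade_weight H 0 \<alpha> \<noteq> {0}}"

definition representing :: "'g set \<Rightarrow> ('g \<Rightarrow> complex) \<Rightarrow> 'g" where
  "representing H \<alpha> = (THE t. t \<in> H \<and> (\<forall>h\<in>H. form t h = \<alpha> h))"

text \<open>The form on \<open>H\<^sup>*\<close> transported from \<open>H\<close>. On the simple algebra \<open>grade 0\<close> the form is a non-zero
  complex multiple of the Killing form, which is positive on the roots; so \<open>cmod\<close> compares
  lengths of roots.\<close>

definition root_length :: "'g set \<Rightarrow> ('g \<Rightarrow> complex) \<Rightarrow> real" where
  "root_length H \<alpha> = cmod (form (representing H \<alpha>) (representing H \<alpha>))"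

definition short_roots :: "'g set \<Rightarrow> ('g \<Rightarrow> complex) set" where
  "short_roots H =
     {\<alpha> \<in> nonzero_roots H. \<forall>\<beta>\<in>nonzero_roots H. root_length H \<alpha> \<le> root_length H \<beta>}"

definition enlarged_nonzero_roots :: "'g set \<Rightarrow> ('g \<Rightarrow> complex) set" where
  "enlarged_nonzero_roots H =
     (if \<exists>l\<ge>1. type_B l (nonzero_roots H)
      then nonzero_roots H \<union> {\<lambda>h. 2 * \<alpha> h | \<alpha>. \<alpha> \<in> short_roots H}
      else nonzero_roots H)"

definition enlarged_roots :: "'g set \<Rightarrow> ('g \<Rightarrow> complex) set" where
  "enlarged_roots H = insert (\<lambda>_. 0) (enlarged_nonzero_roots H)"

definition trivial_plus_irreducible :: "'g set \<Rightarrow> int^'n \<Rightarrow> bool" where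
  "trivial_plus_irreducible H k \<longleftrightarrow> (\<exists>U W.
     subspace U \<and> (\<forall>x\<in>grade 0. \<forall>u\<in>U. bracket x u = 0) \<and>
     subspace W \<and> (\<forall>x\<in>grade 0. \<forall>w\<in>W. bracket x w \<in> W) \<and>
     U \<inter> W = {0} \<and> grade k = {u + w | u w. u \<in> U \<and> w \<in> W} \<and>
     (W = {0} \<or>
        irreducible_under (grade 0) bracket W \<and> dim W > 1 \<and>
        (\<forall>\<alpha>\<in>dual H. (\<exists>w\<in>W. w \<noteq> 0 \<and> (\<forall>h\<in>H. bracket h w = scale (\<alpha> h) w)) \<longrightarrow>
           \<alpha> \<in> enlarged_roots H)))"

end

locale lie_torus = multiloop scale bracket form \<sigma> m \<xi>
  for scale :: "complex \<Rightarrow> 'g::ab_group_add \<Rightarrow> 'g" and bracket :: "'g \<Rightarrow> 'g \<Rightarrow> 'g"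
    and form :: "'g \<Rightarrow> 'g \<Rightarrow> complex"
    and \<sigma> :: "'n::finite \<Rightarrow> 'g \<Rightarrow> 'g" and m :: "'n \<Rightarrow> nat" and \<xi> :: "'n \<Rightarrow> complex" +
  fixes \<hh> :: "'g set"
  assumes grade_0: "fin_dim (grade 0)" "simple (grade 0)" "cartan_subalgebra \<hh> (grade 0)"
    and grade_decomposition:
      "k \<notin> \<Gamma> \<Longrightarrow> grade k \<noteq> {0} \<Longrightarrow> trivial_plus_irreducible \<hh> k"
    and card_generated: "card (generate (BijGroup UNIV) (range \<sigma>)) = (\<Prod>i\<in>UNIV. m i)"
begin

text \<open>\<open>LT\<close> as finitely supported functions on \<open>\<int>\<^sup>n\<close>: \<open>x \<otimes> t\<^sup>k\<close> is \<open>single k x\<close>.\<close>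

definition LT :: "(int^'n \<Rightarrow>\<^sub>0 'g) set" where
  "LT = {f. \<forall>k. Poly_Mapping.lookup f k \<in> grade k}"

definition \<Z> :: "'n symbol_space set" where
  "\<Z> = ss.span {tK k i | k i. k \<in> \<Gamma>}"

text \<open>The graded Lie torus is a subspace of the type of triples \<open>(f, z, d)\<close>; the vector \<open>d\<close>
  stands for \<open>\<Sum>\<^sub>i (d $ i) d\<^sub>i\<close>.\<close>

definition LT_ext :: "((int^'n \<Rightarrow>\<^sub>0 'g) \<times> 'n symbol_space \<times> (complex^'n)) set" where
  "LT_ext = LT \<times> \<Z> \<times> UNIV"

definition ext_scale :: "complex \<Rightarrow> (int^'n \<Rightarrow>\<^sub>0 'g) \<times> 'n symbol_space \<times> (complex^'n) \<Rightarrow>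
    (int^'n \<Rightarrow>\<^sub>0 'g) \<times> 'n symbol_space \<times> (complex^'n)" where
  "ext_scale c = (\<lambda>(f, z, d). (Poly_Mapping.map (scale c) f, sscale c z, c *s d))"

definition loop_bracket :: "(int^'n \<Rightarrow>\<^sub>0 'g) \<Rightarrow> (int^'n \<Rightarrow>\<^sub>0 'g) \<Rightarrow> (int^'n \<Rightarrow>\<^sub>0 'g)" where
  "loop_bracket f g = (\<Sum>k\<in>Poly_Mapping.keys f. \<Sum>l\<in>Poly_Mapping.keys g.
     Poly_Mapping.single (k + l) (bracket (Poly_Mapping.lookup f k) (Poly_Mapping.lookup g l)))"

definition cocycle :: "(int^'n \<Rightarrow>\<^sub>0 'g) \<Rightarrow> (int^'n \<Rightarrow>\<^sub>0 'g) \<Rightarrow> 'n symbol_space" where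
  "cocycle f g = (\<Sum>k\<in>Poly_Mapping.keys f. \<Sum>l\<in>Poly_Mapping.keys g.
     sscale (form (Poly_Mapping.lookup f k) (Poly_Mapping.lookup g l))
       (\<Sum>i\<in>UNIV. sscale (of_int (k $ i)) (tK (k + l) i)))"

definition degree_act :: "complex^'n \<Rightarrow> (int^'n \<Rightarrow>\<^sub>0 'g) \<Rightarrow> (int^'n \<Rightarrow>\<^sub>0 'g)" where
  "degree_act d f = Poly_Mapping.mapp (\<lambda>k x. scale (pairing d k) x) f"

definition ext_bracket :: "(int^'n \<Rightarrow>\<^sub>0 'g) \<times> 'n symbol_space \<times> (complex^'n) \<Rightarrow>
    (int^'n \<Rightarrow>\<^sub>0 'g) \<times> 'n symbol_space \<times> (complex^'n) \<Rightarrow>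
    (int^'n \<Rightarrow>\<^sub>0 'g) \<times> 'n symbol_space \<times> (complex^'n)" where
  "ext_bracket = (\<lambda>(f, z, d) (g, w, e).
     (loop_bracket f g + degree_act d g - degree_act e f,
      cocycle f g + sdegree d w - sdegree e z,
      0))"

definition central_elem :: "'n symbol_space \<Rightarrow>
    (int^'n \<Rightarrow>\<^sub>0 'g) \<times> 'n symbol_space \<times> (complex^'n)" where
  "central_elem z = (0, z, 0)"

definition loop_elem :: "'g \<Rightarrow> int^'n \<Rightarrow>
    (int^'n \<Rightarrow>\<^sub>0 'g) \<times> 'n symbol_space \<times> (complex^'n)" where
  "loop_elem x k = (Poly_Mapping.single k x, 0, 0)"

definition \<hh>_ext :: "((int^'n \<Rightarrow>\<^sub>0 'g) \<times> 'n symbol_space \<times> (complex^'n)) set" where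
  "\<hh>_ext = Poly_Mapping.single 0 ` \<hh> \<times> ss.span (range (tK 0)) \<times> UNIV"

definition ext_dual ::
  "((int^'n \<Rightarrow>\<^sub>0 'g) \<times> 'n symbol_space \<times> (complex^'n) \<Rightarrow> complex) set" where
  "ext_dual = vector_space.dual ext_scale \<hh>_ext"

definition ext_module :: "(complex \<Rightarrow> 'v::ab_group_add \<Rightarrow> 'v) \<Rightarrow>
    ((int^'n \<Rightarrow>\<^sub>0 'g) \<times> 'n symbol_space \<times> (complex^'n) \<Rightarrow> 'v \<Rightarrow> 'v) \<Rightarrow> bool" where
  "ext_module scaleV \<rho> \<longleftrightarrow> lie_module LT_ext ext_scale ext_bracket scaleV \<rho>"

definition irreducible_module :: "(complex \<Rightarrow> 'v::ab_group_add \<Rightarrow> 'v) \<Rightarrow>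
    ((int^'n \<Rightarrow>\<^sub>0 'g) \<times> 'n symbol_space \<times> (complex^'n) \<Rightarrow> 'v \<Rightarrow> 'v) \<Rightarrow> bool" where
  "irreducible_module scaleV \<rho> \<longleftrightarrow> vector_space.irreducible_under scaleV LT_ext \<rho> UNIV"

definition weight_space :: "(complex \<Rightarrow> 'v::ab_group_add \<Rightarrow> 'v) \<Rightarrow>
    ((int^'n \<Rightarrow>\<^sub>0 'g) \<times> 'n symbol_space \<times> (complex^'n) \<Rightarrow> 'v \<Rightarrow> 'v) \<Rightarrow>
    ((int^'n \<Rightarrow>\<^sub>0 'g) \<times> 'n symbol_space \<times> (complex^'n) \<Rightarrow> complex) \<Rightarrow> 'v set" where
  "weight_space scaleV \<rho> \<mu> = {v. \<forall>h\<in>\<hh>_ext. \<rho> h v = scaleV (\<mu> h) v}"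

definition integrable_module :: "(complex \<Rightarrow> 'v::ab_group_add \<Rightarrow> 'v) \<Rightarrow>
    ((int^'n \<Rightarrow>\<^sub>0 'g) \<times> 'n symbol_space \<times> (complex^'n) \<Rightarrow> 'v \<Rightarrow> 'v) \<Rightarrow> bool" where
  "integrable_module scaleV \<rho> \<longleftrightarrow>
     vector_space.direct_sum_of scaleV ext_dual (weight_space scaleV \<rho>) UNIV \<and>
     (\<forall>\<mu>\<in>ext_dual. vector_space.fin_dim scaleV (weight_space scaleV \<rho> \<mu>)) \<and>
     (\<forall>k. \<forall>\<alpha>\<in>dual \<hh>. \<alpha> \<noteq> (\<lambda>_. 0) \<longrightarrow> (\<forall>x\<in>grade_weight \<hh> k \<alpha>.
        \<forall>v. \<exists>N. (\<rho> (loop_elem x k) ^^ N) v = 0))"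

end

end

theory Submission
  imports Defs "HOL-Computational_Algebra.Fundamental_Theorem_Algebra"
begin

text \<open>
  The kernel of a homogeneous central element is a submodule, so such an element acts injectively
  or by \<open>0\<close>; it suffices to find a non-zero vector that it kills. If \<open>\<gg>\<^sub>0\<close> acts by \<open>0\<close>, then so do
  all \<open>x(k)\<close> with \<open>x \<in> \<gg>\<^sub>0\<close> and \<open>k \<in> \<Gamma>\<close>, and their brackets. Otherwise \<open>\<gg>\<^sub>0\<close> is represented
  faithfully, and since \<open>\<hh>\<close> is diagonalizable on the module, it is commutative and diagonalizable
  on \<open>\<gg>\<^sub>0\<close>. This gives an \<open>sl\<^sub>2\<close>-triple \<open>e, f, h\<close> of root vectors in \<open>\<gg>\<^sub>0\<close>.

  At level \<open>0\<close> the elements \<open>e(p), f(-p), h\<close> form an \<open>sl\<^sub>2\<close>-triple for every \<open>p \<in> \<Gamma>\<close>. Therefore,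
  as long as \<open>h\<close> acts by positive numbers, each step by the root of \<open>e\<close> does not increase the
  (finite) dimensions of the weight spaces, whatever the accompanying shift of degree in \<open>\<Gamma>\<close>. They
  become constant, and the constant is \<open>0\<close> because \<open>e\<close> is locally nilpotent. So there is a weight
  vector \<open>v \<noteq> 0\<close> that is killed by all \<open>e(p)\<close>, and by all products of \<open>N\<close> factors \<open>f(q)\<close> for a
  large \<open>N\<close>. Since \<open>[e(p), f(k - p)] = h(k) + (e|f) z(p)\<close> with \<open>z(p) = \<Sum>\<^sub>i p\<^sub>i t\<^sup>k K\<^sub>i\<close> additive in
  \<open>p\<close>, the vector \<open>e(jw)\<^sup>N f(k - jw)\<^sup>N v = 0\<close> is a polynomial in \<open>j\<close> with leading coefficient
  \<open>N! (e|f)\<^sup>N z(w)\<^sup>N v\<close>. Hence \<open>z(w)\<close> is not injective.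
\<close>

section \<open>Linear algebra\<close>

locale complex_space = vector_space scale
  for scale :: "complex \<Rightarrow> 'b::ab_group_add \<Rightarrow> 'b"
begin

definition endo :: "('b \<Rightarrow> 'b) \<Rightarrow> bool" where
  "endo f \<longleftrightarrow> Vector_Spaces.linear scale scale f"

lemma endo_iff:
  "endo f \<longleftrightarrow> (\<forall>x y. f (x + y) = f x + f y) \<and> (\<forall>c x. f (scale c x) = scale c (f x))"
  by (simp add: endo_def Vector_Spaces.linear_iff vector_space_axioms)

lemma endo_add: "endo f \<Longrightarrow> f (x + y) = f x + f y"
  and endo_scale: "endo f \<Longrightarrow> f (scale c x) = scale c (f x)"
  by (simp_all add: endo_iff)

lemma endo_0: "endo f \<Longrightarrow> f 0 = 0"
  by (metis endo_scale scale_zero_left)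

lemma endo_minus: "endo f \<Longrightarrow> f (- x) = - f x"
  by (metis add.right_inverse endo_0 endo_add add_eq_0_iff)

lemma endo_diff: "endo f \<Longrightarrow> f (x - y) = f x - f y"
  by (metis diff_conv_add_uminus endo_add endo_minus)

lemma endo_sum: "endo f \<Longrightarrow> f (\<Sum>i\<in>I. g i) = (\<Sum>i\<in>I. f (g i))"
  by (induction I rule: infinite_finite_induct) (auto simp: endo_0 endo_add)

lemma endo_funpow: "endo f \<Longrightarrow> endo (f ^^ n)"
  by (induction n) (auto simp: endo_iff)

lemma funpow_last_nonzero:
  fixes f :: "'b \<Rightarrow> 'b"
  assumes "v \<noteq> 0" "(f ^^ N) v = 0"
  obtains n where "(f ^^ n) v \<noteq> 0" "f ((f ^^ n) v) = 0"
proof -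
  define M where "M = (LEAST N. (f ^^ N) v = 0)"
  have M: "(f ^^ M) v = 0"
    unfolding M_def by (rule LeastI) (rule assms)
  then obtain n where n: "M = Suc n"
    using assms(1) by (cases M) auto
  then have "(f ^^ n) v \<noteq> 0"
    using not_less_Least[of n "\<lambda>N. (f ^^ N) v = 0"] by (auto simp: M_def)
  then show thesis using that M n by simp
qed

text \<open>The image of a basis of \<open>S\<close> stays independent. If the dimensions agree,
  extending it to a basis of \<open>S'\<close> adds nothing; this later yields preimages under
  lowering operators.\<close>

lemma dim_le_of_injective:
  assumes f: "endo f" and S: "subspace S" "fin_dim S" and S': "subspace S'" "fin_dim S'"
    and im: "\<And>x. x \<in> S \<Longrightarrow> f x \<in> S'" and ker: "\<And>x. x \<in> S \<Longrightarrow> f x = 0 \<Longrightarrow> x = 0"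
  shows "dim S \<le> dim S'" and "dim S = dim S' \<Longrightarrow> S' \<subseteq> f ` S"
proof -
  interpret vector_space_pair scale scale by unfold_locales
  obtain B where B: "B \<subseteq> S" "independent B" "S \<subseteq> span B" "card B = dim S"
    by (rule basis_exists)
  obtain C where C: "finite C" "S' = span C" using S'(2) unfolding fin_dim_def by blast
  obtain B' where B': "B' \<subseteq> S'" "independent B'" "S' \<subseteq> span B'" "card B' = dim S'"
    by (rule basis_exists)
  have finB': "finite B'" using independent_span_bound[OF C(1) B'(2)] B'(1) C(2) by auto
  have spB: "span B = S" using B S(1) by (metis span_minimal subset_antisym)
  have inj: "inj_on f S"
    by (rule inj_onI) (metis S(1) eq_iff_diff_eq_0 endo_diff[OF f] ker subspace_diff)
  have ind: "independent (f ` B)"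
    by (rule linear_independent_injective_image[OF f[unfolded endo_def] B(2)]) (simp add: spB inj)
  have sub: "f ` B \<subseteq> S'" using im B(1) by auto
  have cardfB: "card (f ` B) = dim S" using card_image inj_on_subset[OF inj B(1)] B(4) by metis
  have fin: "finite (f ` B)" "card (f ` B) \<le> card B'"
    using independent_span_bound[OF finB' ind] sub B'(3) by auto
  then show "dim S \<le> dim S'" using cardfB B'(4) by simp
  assume eq: "dim S = dim S'"
  obtain D where D: "f ` B \<subseteq> D" "D \<subseteq> S'" "independent D" "S' \<subseteq> span D"
    using maximal_independent_subset_extend[OF sub ind] .
  have "finite D \<and> card D \<le> card B'"
    using independent_span_bound[OF finB' D(3)] D(2) B'(3) by auto
  then have "f ` B = D" using D(1) eq cardfB B'(4) by (metis card_seteq)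
  then have "S' \<subseteq> span (f ` B)" using D by simp
  also have "\<dots> = f ` S" using linear_span_image[OF f[unfolded endo_def]] spB by simp
  finally show "S' \<subseteq> f ` S" .
qed

lemma dim_pos:
  assumes "fin_dim S" "v \<in> S" "v \<noteq> 0"
  shows "dim S > 0"
proof -
  obtain C where C: "finite C" "S = span C" using assms(1) unfolding fin_dim_def by blast
  obtain B where B: "B \<subseteq> S" "independent B" "S \<subseteq> span B" "card B = dim S"
    by (rule basis_exists)
  have "finite B" using independent_span_bound[OF C(1) B(2)] B(1) C(2) by auto
  moreover have "B \<noteq> {}" using B(3) assms(2,3) by auto
  ultimately show ?thesis using B(4) card_gt_0_iff by metis
qed

text \<open>The coordinate at \<open>u\<close> in a basis containing a non-zero \<open>u\<close> is
  a linear functional. It would turn the hypothesis into a monic complex polynomial that vanishes at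
  every natural number.\<close>

lemma leading_coefficient_eq_0:
  fixes c :: "nat \<Rightarrow> 'b"
  assumes zero: "\<And>j. (\<Sum>i<d. scale (of_nat j ^ i) (c i)) + scale (of_nat j ^ d) u = 0"
  shows "u = 0"
proof (rule ccontr)
  assume "u \<noteq> 0"
  then have "independent {u}" by simp
  then obtain B where B: "{u} \<subseteq> B" "independent B" "UNIV \<subseteq> span B"
    using maximal_independent_subset_extend[of "{u}" UNIV] by auto
  define \<phi> where "\<phi> x = representation B x u" for x
  have sp: "x \<in> span B" for x using B by auto
  have \<phi>: "\<phi> (x + y) = \<phi> x + \<phi> y" "\<phi> (scale a x) = a * \<phi> x" for x y a
    using representation_add[OF B(2) sp sp] representation_scale[OF B(2) sp] by (simp_all add: \<phi>_def)
  have \<phi>0: "\<phi> 0 = 0" using \<phi>(2)[of 0 0] by simp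
  have \<phi>s: "\<phi> (\<Sum>i\<in>I. g i) = (\<Sum>i\<in>I. \<phi> (g i))" for I :: "nat set" and g
    by (induction I rule: infinite_finite_induct) (auto simp: \<phi> \<phi>0)
  have \<phi>u: "\<phi> u = 1" using representation_basis[OF B(2), of u] B(1) by (simp add: \<phi>_def)
  define p where "p = (\<Sum>i<d. monom (\<phi> (c i)) i) + monom 1 d"
  have "poly p (of_nat j) = \<phi> ((\<Sum>i<d. scale (of_nat j ^ i) (c i)) + scale (of_nat j ^ d) u)" for j
    by (simp add: p_def \<phi> \<phi>s \<phi>u poly_sum poly_monom mult.commute)
  then have "poly p (of_nat j) = 0" for j using zero \<phi>0 by simp
  then have "range (of_nat :: nat \<Rightarrow> complex) \<subseteq> {x. poly p x = 0}" by auto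
  moreover have "infinite (range (of_nat :: nat \<Rightarrow> complex))"
    by (rule range_inj_infinite) (rule inj_of_nat)
  ultimately have "p = 0" using finite_subset poly_roots_finite by blast
  moreover have "coeff p d = 1"
    by (auto simp: p_def coeff_sum)
  ultimately show False by simp
qed

text \<open>As in the Fock representation: if \<open>P u = 0\<close> and \<open>T u = c u\<close>,
  then \<open>P\<close> sends \<open>Q^(l+1) u\<close> to \<open>(l+1) c Q^l u\<close>. At the last
  non-zero \<open>Q^l u\<close> this forces \<open>c = 0\<close>.\<close>

lemma heisenberg_nilpotent:
  assumes P: "endo P" and Q: "endo Q" and PQ: "\<And>x. P (Q x) = Q (P x) + T x"
    and TP: "\<And>x. T (P x) = P (T x)" and TQ: "\<And>x. T (Q x) = Q (T x)"
    and nil: "\<And>x. \<exists>N. (P ^^ N) x = 0" "\<And>x. \<exists>N. (Q ^^ N) x = 0"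
    and T: "T v = scale c v" and v: "v \<noteq> 0"
  shows "c = 0"
proof -
  obtain N where "(P ^^ N) v = 0" using nil(1) by blast
  then obtain n where n: "(P ^^ n) v \<noteq> 0" "P ((P ^^ n) v) = 0"
    using funpow_last_nonzero v by blast
  define u where "u = (P ^^ n) v"
  have Tu: "T u = scale c u"
    unfolding u_def by (induction n) (auto simp: T TP endo_scale[OF P])
  have TQu: "T ((Q ^^ l) u) = scale c ((Q ^^ l) u)" for l
    by (induction l) (auto simp: Tu TQ endo_scale[OF Q])
  have PQu: "P ((Q ^^ Suc l) u) = scale (of_nat (Suc l) * c) ((Q ^^ l) u)" for l
  proof (induction l)
    case 0
    then show ?case using n(2) by (simp add: PQ Tu endo_0[OF Q] flip: u_def)
  next
    case (Suc l)
    have "P ((Q ^^ Suc (Suc l)) u) = Q (P ((Q ^^ Suc l) u)) + T ((Q ^^ Suc l) u)"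
      by (simp add: PQ)
    also have "\<dots> = scale (of_nat (Suc l) * c) ((Q ^^ Suc l) u) + scale c ((Q ^^ Suc l) u)"
      unfolding Suc TQu by (simp add: endo_scale[OF Q])
    also have "\<dots> = scale (of_nat (Suc (Suc l)) * c) ((Q ^^ Suc l) u)"
      by (simp only: scale_left_distrib[symmetric]) (simp add: algebra_simps)
    finally show ?case .
  qed
  obtain N' where "(Q ^^ N') u = 0" using nil(2) by blast
  then obtain l where l: "(Q ^^ l) u \<noteq> 0" "Q ((Q ^^ l) u) = 0"
    using funpow_last_nonzero n(1) unfolding u_def by blast
  then have "scale (of_nat (Suc l) * c) ((Q ^^ l) u) = 0"
    using PQu[of l] endo_0[OF P] by simp
  then have "of_nat (Suc l) * c = 0" using l(1) by (simp only: scale_eq_0_iff simp_thms)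
  then show "c = 0" by (simp only: mult_eq_0_iff of_nat_eq_0_iff nat.distinct simp_thms)
qed

section \<open>Polynomials in an endomorphism and diagonalizability\<close>

definition poly_act :: "('b \<Rightarrow> 'b) \<Rightarrow> complex poly \<Rightarrow> 'b \<Rightarrow> 'b" where
  "poly_act f p x = (\<Sum>i\<le>degree p. scale (coeff p i) ((f ^^ i) x))"

lemma poly_act_atMost:
  assumes "degree p \<le> n"
  shows "poly_act f p x = (\<Sum>i\<le>n. scale (coeff p i) ((f ^^ i) x))"
  unfolding poly_act_def
  by (rule sum.mono_neutral_left) (use assms in \<open>auto simp: coeff_eq_0\<close>)

lemma poly_act_linear_factor:
  assumes "endo f"
  shows "poly_act f ([:-c, 1:] * q) x = poly_act f q (f x - scale c x)"
proof -
  let ?p = "[:-c, 1:] * q"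
  have "degree ?p \<le> Suc (degree q)"
    using degree_mult_le[of "[:-c, 1:]" q] by simp
  then have "poly_act f ?p x = (\<Sum>i\<le>Suc (degree q). scale (coeff ?p i) ((f ^^ i) x))"
    by (rule poly_act_atMost)
  also have "\<dots> = (\<Sum>i\<le>Suc (degree q). scale (coeff (pCons 0 q) i) ((f ^^ i) x)) -
      (\<Sum>i\<le>Suc (degree q). scale (c * coeff q i) ((f ^^ i) x))"
    by (simp add: scale_left_diff_distrib sum_subtractf[symmetric] del: sum.atMost_Suc)
  also have "(\<Sum>i\<le>Suc (degree q). scale (coeff (pCons 0 q) i) ((f ^^ i) x)) =
      (\<Sum>i\<le>degree q. scale (coeff q i) ((f ^^ i) (f x)))"
    by (subst sum.atMost_Suc_shift) (simp add: funpow_swap1)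
  also have "(\<Sum>i\<le>Suc (degree q). scale (c * coeff q i) ((f ^^ i) x)) =
      (\<Sum>i\<le>degree q. scale (coeff q i) ((f ^^ i) (scale c x)))"
    by (simp add: coeff_eq_0 endo_scale[OF endo_funpow[OF assms]] mult.commute)
  also have "(\<Sum>i\<le>degree q. scale (coeff q i) ((f ^^ i) (f x))) -
      (\<Sum>i\<le>degree q. scale (coeff q i) ((f ^^ i) (scale c x))) =
      (\<Sum>i\<le>degree q. scale (coeff q i) ((f ^^ i) (f x - scale c x)))"
    by (simp add: sum_subtractf[symmetric] endo_diff[OF endo_funpow[OF assms]]
        scale_right_diff_distrib)
  finally show ?thesis by (simp add: poly_act_def)
qed

text \<open>The \<open>n + 1\<close> vectors \<open>f^i x\<close> with \<open>i \<le> n\<close> lie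
  in a space spanned by \<open>n\<close> vectors; the coefficients of a linear relation between them
  form \<open>p\<close>.\<close>

lemma ex_annihilating_poly:
  assumes "fin_dim UNIV"
  shows "\<exists>p. p \<noteq> 0 \<and> poly_act f p x = 0"
proof -
  obtain C where C: "finite C" "span C = UNIV" using assms unfolding fin_dim_def by metis
  define n where "n = card C"
  define g where "g i = (f ^^ i) x" for i
  show ?thesis
  proof (cases "inj_on g {..n}")
    \<comment> \<open>Dependence of a set does not see repetitions, so a coincidence
      \<open>f^i x = f^j x\<close> is treated apart, with the polynomial
      \<open>t^i - t^j\<close>.\<close>
    case False
    then obtain i j where "i \<noteq> j" "g i = g j" by (auto simp: inj_on_def)
    define p :: "complex poly" where "p = monom 1 i - monom 1 j"
    have "coeff p i = 1" using \<open>i \<noteq> j\<close> by (simp add: p_def)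
    then have "p \<noteq> 0" by auto
    have "poly_act f p x = (\<Sum>l\<le>i + j. scale (coeff p l) (g l))"
      unfolding g_def p_def
      by (rule poly_act_atMost) (auto intro!: degree_diff_le order.trans[OF degree_monom_le])
    also have "\<dots> = (\<Sum>l\<le>i + j. if l = i then g l else 0) - (\<Sum>l\<le>i + j. if l = j then g l else 0)"
      unfolding sum_subtractf[symmetric]
      by (rule sum.cong) (auto simp: p_def scale_left_diff_distrib)
    also have "\<dots> = 0" using \<open>g i = g j\<close> by simp
    finally show ?thesis using \<open>p \<noteq> 0\<close> by blast
  next
    case True
    then have "card (g ` {..n}) = Suc n" by (simp add: card_image)
    then have "dependent (g ` {..n})"
      using independent_span_bound[OF C(1), of "g ` {..n}"] C(2) by (auto simp: n_def)
    then obtain u v where u: "(\<Sum>y\<in>g ` {..n}. scale (u y) y) = 0" and v: "v \<in> g ` {..n}" "u v \<noteq> 0"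
      by (auto simp: dependent_finite)
    define p where "p = (\<Sum>i\<le>n. monom (u (g i)) i)"
    have cp: "coeff p i = (if i \<le> n then u (g i) else 0)" for i
      by (simp add: p_def coeff_sum)
    then have "degree p \<le> n" by (intro degree_le) simp
    then have "poly_act f p x = (\<Sum>i\<le>n. scale (u (g i)) (g i))"
      by (simp add: poly_act_atMost cp g_def)
    also have "\<dots> = 0" using u by (simp add: sum.reindex[OF True])
    finally have "poly_act f p x = 0" .
    moreover have "p \<noteq> 0" using v cp by (metis atMost_iff coeff_0 image_iff)
    ultimately show ?thesis by blast
  qed
qed

text \<open>By \<open>ss\<close>, \<open>(f - c)^2 x = 0\<close> implies
  \<open>(f - c) x = 0\<close> on \<open>S\<close>. Splitting a root \<open>c\<close> off an
  annihilating polynomial of \<open>x\<close> puts \<open>(f - c) x\<close> into the span, by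
  induction on the degree. Subtracting from \<open>x\<close> a suitable \<open>x'\<close> in the
  span then leaves a vector killed by \<open>(f - c)^2\<close>, hence an eigenvector.\<close>

lemma span_eigenvectors:
  assumes f: "endo f" and fd: "fin_dim UNIV" and S: "subspace S" and inv: "\<And>x. x \<in> S \<Longrightarrow> f x \<in> S"
    and ss: "\<And>c x. x \<in> S \<Longrightarrow> f (f x - scale c x) = scale c (f x - scale c x) \<Longrightarrow> f x = scale c x"
  shows "S \<subseteq> span {x \<in> S. \<exists>c. f x = scale c x}" (is "_ \<subseteq> span ?X")
proof
  have X: "span ?X \<subseteq> S" by (rule span_minimal) (auto simp: S)
  \<comment> \<open>On the span, \<open>f - c\<close> can be inverted except on the eigenvectors for
    \<open>c\<close> itself, which are collected in \<open>z\<close>.\<close>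
  have shift: "\<exists>x'\<in>span ?X. \<exists>z\<in>S. f z = scale c z \<and> y = f x' - scale c x' + z"
    if "y \<in> span ?X" for c y
    using that
  proof (induction rule: span_induct_alt)
    case base
    show ?case
      by (rule bexI[of _ 0], rule bexI[of _ 0])
        (auto simp: endo_0[OF f] span_zero subspace_0[OF S])
  next
    case (step k x y)
    then obtain d x' z where x: "x \<in> S" "f x = scale d x" and x': "x' \<in> span ?X"
      and z: "z \<in> S" "f z = scale c z" and y: "y = f x' - scale c x' + z" by blast
    have xX: "x \<in> span ?X" using step(1) by (rule span_base)
    show ?case
    proof (cases "d = c")
      case True
      then have "f (scale k x + z) = scale c (scale k x + z)"
        using x z by (simp add: endo_add[OF f] endo_scale[OF f] scale_right_distrib mult.commute)
      moreover have "scale k x + z \<in> S" using x z S by (simp add: subspace_add subspace_scale)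
      moreover have "scale k x + y = f x' - scale c x' + (scale k x + z)" using y by simp
      ultimately show ?thesis using x' by blast
    next
      case False
      define r where "r = k / (d - c)"
      have r: "r * (d - c) = k" using False by (simp add: r_def)
      let ?x = "scale r x + x'"
      have "f ?x - scale c ?x = scale (r * (d - c)) x + (f x' - scale c x')"
        unfolding right_diff_distrib scale_left_diff_distrib
        by (simp add: endo_add[OF f] endo_scale[OF f] x scale_right_distrib mult.commute)
      then have "scale k x + y = f ?x - scale c ?x + z" using r y by (simp add: add.assoc)
      moreover have "?x \<in> span ?X" using xX x' by (simp add: span_add span_scale)
      ultimately show ?thesis using z by blast
    qed
  qed
  have *: "x \<in> span ?X" if "x \<in> S" "p \<noteq> 0" "poly_act f p x = 0" for x p
    using that
  proof (induction "degree p" arbitrary: p x rule: less_induct)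
    case less
    show ?case
    proof (cases "degree p = 0")
      case True
      then obtain k where "p = [:k:]" by (rule degree_eq_zeroE)
      then have "x = 0" using less.prems by (simp add: poly_act_def)
      then show ?thesis by (simp add: span_zero)
    next
      case False
      then have "\<not> constant (poly p)" by (simp add: constant_degree)
      then obtain c where "poly p c = 0" using fundamental_theorem_of_algebra by blast
      then obtain q where q: "p = [:-c, 1:] * q" by (auto simp: poly_eq_0_iff_dvd)
      have "q \<noteq> 0" using q less.prems(2) by auto
      then have "degree q < degree p" unfolding q by (subst degree_mult_eq) auto
      moreover have "f x - scale c x \<in> S"
        using S inv less.prems(1) by (simp add: subspace_diff subspace_scale)
      moreover have "poly_act f q (f x - scale c x) = 0"
        using less.prems(3) unfolding q poly_act_linear_factor[OF f] .
      ultimately have "f x - scale c x \<in> span ?X" using less.hyps \<open>q \<noteq> 0\<close> by blast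
      from shift[OF this, of c] obtain x' z where x': "x' \<in> span ?X"
        and z: "f z = scale c z" and eq: "f x - scale c x = f x' - scale c x' + z"
        by blast
      have "x - x' \<in> S" using X x' less.prems(1) S by (auto intro: subspace_diff)
      moreover have "f (x - x') - scale c (x - x') = z"
        using eq by (simp add: endo_diff[OF f] scale_right_diff_distrib algebra_simps)
      ultimately have "f (x - x') = scale c (x - x')" using ss[of "x - x'" c] z by simp
      then have "x - x' \<in> ?X" using \<open>x - x' \<in> S\<close> by blast
      then have "(x - x') + x' \<in> span ?X" by (rule span_add[OF span_base x'])
      then show ?thesis by simp
    qed
  qed
  fix x assume "x \<in> S"
  then show "x \<in> span ?X" using * ex_annihilating_poly[OF fd, of f x] by blast
qed

text \<open>Induction on the family: the vectors of \<open>S\<close> with prescribed eigenvalues for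
  the earlier maps form a subspace, stable under the next map because the maps commute, and
  \<open>span_eigenvectors\<close> applies to it.\<close>

lemma span_joint_eigenvectors:
  assumes "finite \<F>" and f: "\<And>f. f \<in> \<F> \<Longrightarrow> endo f" and fd: "fin_dim UNIV" and S: "subspace S"
    and inv: "\<And>f x. f \<in> \<F> \<Longrightarrow> x \<in> S \<Longrightarrow> f x \<in> S"
    and comm: "\<And>f g x. f \<in> \<F> \<Longrightarrow> g \<in> \<F> \<Longrightarrow> x \<in> S \<Longrightarrow> f (g x) = g (f x)"
    and ss: "\<And>f c x. f \<in> \<F> \<Longrightarrow> x \<in> S \<Longrightarrow>
      f (f x - scale c x) = scale c (f x - scale c x) \<Longrightarrow> f x = scale c x"
  shows "S \<subseteq> span {x \<in> S. \<forall>f\<in>\<F>. \<exists>c. f x = scale c x}"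
  using assms(1,2,5-7)
proof (induction rule: finite_induct)
  case empty
  then show ?case by (auto intro: span_base)
next
  case (insert f \<F>)
  let ?X = "{x \<in> S. \<forall>g\<in>insert f \<F>. \<exists>c. g x = scale c x}"
  have "S \<subseteq> span {x \<in> S. \<forall>g\<in>\<F>. \<exists>c. g x = scale c x}"
    by (rule insert.IH) (use insert.prems in auto)
  also have "\<dots> \<subseteq> span ?X"
  proof (rule span_minimal)
    show "{x \<in> S. \<forall>g\<in>\<F>. \<exists>c. g x = scale c x} \<subseteq> span ?X"
    proof safe
      fix x assume x: "x \<in> S" "\<forall>g\<in>\<F>. \<exists>c. g x = scale c x"
      then obtain c where c: "\<And>g. g \<in> \<F> \<Longrightarrow> g x = scale (c g) x" by metis
      define T where "T = {y \<in> S. \<forall>g\<in>\<F>. g y = scale (c g) y}"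
      have "subspace T"
        unfolding T_def using S insert.prems(1)
        by (auto simp: subspace_def endo_0 endo_add endo_scale scale_right_distrib mult.commute)
      moreover have "f y \<in> T" if "y \<in> T" for y
      proof -
        have y: "y \<in> S" "\<And>g. g \<in> \<F> \<Longrightarrow> g y = scale (c g) y" using that by (auto simp: T_def)
        have "g (f y) = scale (c g) (f y)" if "g \<in> \<F>" for g
          using insert.prems(3)[of g f y] that y(1) insert.prems(1)[of f]
          by (simp add: endo_scale y(2)[OF that])
        then show ?thesis using y insert.prems(2)[of f y] by (simp add: T_def)
      qed
      ultimately have "T \<subseteq> span {y \<in> T. \<exists>c. f y = scale c y}"
        by (intro span_eigenvectors fd insert.prems(1)) (auto simp: T_def intro: insert.prems(4))
      also have "\<dots> \<subseteq> span ?X" by (rule span_mono) (auto simp: T_def)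
      finally show "x \<in> span ?X" using x c by (auto simp: T_def)
    qed
  qed simp
  finally show ?case .
qed

end

section \<open>Modules over \<open>sl\<^sub>2\<close>\<close>

locale sl2_action = complex_space scale
  for scale :: "complex \<Rightarrow> 'v::ab_group_add \<Rightarrow> 'v" +
  fixes e f h :: "'v \<Rightarrow> 'v"
  assumes endo_e: "endo e" and endo_f: "endo f" and endo_h: "endo h"
    and ef: "e (f v) = f (e v) + h v"
    and he: "h (e v) = e (h v) + scale 2 (e v)"
    and hf: "h (f v) = f (h v) - scale 2 (f v)"
begin

text \<open>This symmetry turns statements on lowest weights into statements on highest
  weights.\<close>

lemma sl2_swap: "sl2_action scale f e (\<lambda>v. - h v)"
  by unfold_locales
    (use endo_e endo_f endo_h in \<open>auto simp: ef he hf endo_iff endo_minus endo_diff\<close>)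

lemma weight_e_funpow:
  assumes "h v = scale a v"
  shows "h ((e ^^ n) v) = scale (a + 2 * of_nat n) ((e ^^ n) v)"
proof (induction n)
  case (Suc n)
  then show ?case
    by (simp add: he endo_scale[OF endo_e] scale_left_distrib endo_add[OF endo_e] algebra_simps)
qed (use assms in simp)

text \<open>The commutators contribute the weights \<open>a, a + 2, ..., a + 2n\<close> of the
  intermediate vectors, whose sum is \<open>(n + 1)(a + n)\<close>.\<close>

lemma f_e_funpow:
  assumes "f v = 0" "h v = scale a v"
  shows "f ((e ^^ Suc n) v) = scale (- (of_nat (Suc n) * (a + of_nat n))) ((e ^^ n) v)"
proof -
  have fe: "f (e x) = e (f x) - h x" for x by (simp add: ef)
  show ?thesis
  proof (induction n)
    case 0
    then show ?case using assms by (simp add: fe endo_0[OF endo_e])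
  next
    case (Suc n)
    have "f ((e ^^ Suc (Suc n)) v) = e (f ((e ^^ Suc n) v)) - h ((e ^^ Suc n) v)"
      by (simp add: fe)
    also have "\<dots> = scale (- (of_nat (Suc n) * (a + of_nat n)) - (a + 2 * of_nat (Suc n)))
        ((e ^^ Suc n) v)"
      unfolding Suc weight_e_funpow[OF assms(2)]
      by (simp only: endo_scale[OF endo_e] scale_left_diff_distrib funpow.simps o_apply)
    also have "- (of_nat (Suc n) * (a + of_nat n)) - (a + 2 * of_nat (Suc n)) =
        - (of_nat (Suc (Suc n)) * (a + of_nat (Suc n)))"
      by (simp add: algebra_simps)
    finally show ?case .
  qed
qed

text \<open>At the last non-zero \<open>e^n v\<close> the coefficient \<open>(n + 1)(a + n)\<close>
  has to vanish. This vector has weight \<open>- a\<close>, which is the reflection of weights used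
  below.\<close>

lemma lowest_weight:
  assumes "f v = 0" "h v = scale a v" "v \<noteq> 0" "(e ^^ N) v = 0"
  obtains n where "a = - of_nat n" "(e ^^ n) v \<noteq> 0"
proof -
  obtain n where n: "(e ^^ n) v \<noteq> 0" "e ((e ^^ n) v) = 0"
    using funpow_last_nonzero[OF assms(3,4)] .
  then have "scale (- (of_nat (Suc n) * (a + of_nat n))) ((e ^^ n) v) = 0"
    using f_e_funpow[OF assms(1,2), of n] endo_0[OF endo_f] by simp
  then have "of_nat (Suc n) * (a + of_nat n) = 0" using n(1) by simp
  then have "a = - of_nat n"
    by (metis add_eq_0_iff2 mult_eq_0_iff of_nat_eq_0_iff nat.distinct(1))
  then show thesis using that n by blast
qed

lemma highest_weight:
  assumes "e v = 0" "h v = scale a v" "v \<noteq> 0" "(f ^^ N) v = 0"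
  obtains n where "a = of_nat n" "(f ^^ n) v \<noteq> 0"
proof -
  interpret sw: sl2_action scale f e "\<lambda>v. - h v" by (rule sl2_swap)
  show thesis
    using sw.lowest_weight[of v "- a" N] assms that by fastforce
qed

text \<open>Since \<open>f (e u) = - (c + a) u\<close> and \<open>c + a > 0\<close>, the vector
  \<open>e u\<close> is not zero, and it satisfies the hypotheses again with \<open>a + 2\<close>
  and \<open>c + a\<close> in place of \<open>a\<close> and \<open>c\<close>.\<close>

lemma e_funpow_nonzero:
  assumes "u \<noteq> 0" "h u = scale (of_nat a) u" "a > 0" "e (f u) = scale (- of_nat c) u"
  shows "(e ^^ i) u \<noteq> 0"
  using assms
proof (induction i arbitrary: u a c)
  case (Suc i)
  have "f (e u) = e (f u) - h u" by (simp add: ef)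
  also have "\<dots> = scale (- of_nat (c + a)) u"
    unfolding Suc.prems by (simp only: scale_left_diff_distrib[symmetric]) simp
  finally have fe: "f (e u) = scale (- of_nat (c + a)) u" .
  have "e u \<noteq> 0"
  proof
    assume "e u = 0"
    then have "scale (- of_nat (c + a)) u = 0" using fe endo_0[OF endo_f] by simp
    then have "(of_nat (c + a) :: complex) = 0"
      using Suc.prems(1) by (simp only: scale_eq_0_iff neg_equal_0_iff_equal simp_thms)
    then show False using Suc.prems(3) by (simp only: of_nat_eq_0_iff)
  qed
  moreover have "h (e u) = scale (of_nat (a + 2)) (e u)"
    using Suc.prems(2) by (simp add: he endo_scale[OF endo_e] algebra_simps)
  moreover have "e (f (e u)) = scale (- of_nat (c + a)) (e u)"
    unfolding fe by (simp only: endo_scale[OF endo_e])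
  ultimately have "(e ^^ i) (e u) \<noteq> 0" using Suc.IH[of "e u" "a + 2" "c + a"] by simp
  then show ?case by (simp add: funpow_swap1)
qed simp

end

section \<open>Level zero loop algebras of \<open>sl\<^sub>2\<close>\<close>

text \<open>An abstract form of the operators \<open>e(p)\<close>, \<open>f(p)\<close>,
  \<open>h(p)\<close>. \<open>Z p k\<close> is the central term of \<open>[e(p), f(k - p)]\<close>;
  the total degree \<open>k\<close> is a separate index so that additivity in \<open>p\<close> can
  be stated for fixed \<open>k\<close>. \<open>HE\<close> and \<open>HF\<close> carry no central
  term because \<open>h\<close> is orthogonal to \<open>e\<close> and \<open>f\<close>.\<close>

locale loop_sl2 = complex_space scale
  for scale :: "complex \<Rightarrow> 'v::ab_group_add \<Rightarrow> 'v" +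
  fixes E F H :: "int^'n::finite \<Rightarrow> 'v \<Rightarrow> 'v"
    and Z :: "int^'n \<Rightarrow> int^'n \<Rightarrow> 'v \<Rightarrow> 'v"
  assumes endo_E: "endo (E p)" and endo_F: "endo (F p)" and endo_H: "endo (H p)"
    and endo_Z: "endo (Z p k)"
    and EF: "E p (F q v) = F q (E p v) + H (p + q) v + Z p (p + q) v"
    and HE: "H p (E q v) = E q (H p v) + scale 2 (E (p + q) v)"
    and HF: "H p (F q v) = F q (H p v) - scale 2 (F (p + q) v)"
    and ZE: "Z p k (E q v) = E q (Z p k v)"
    and ZF: "Z p k (F q v) = F q (Z p k v)"
    and Z_add: "Z (p + q) k v = Z p k v + Z q k v"
begin

lemma Z_mult: "Z (int j *s w) k v = scale (of_nat j) (Z w k v)"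
proof (induction j)
  case 0
  then show ?case using Z_add[of 0 0 k v] by simp
next
  case (Suc j)
  have "int (Suc j) *s w = int j *s w + w"
    by (simp add: vector_sadd_rdistrib)
  then show ?case using Suc by (simp add: Z_add scale_left_distrib add.commute)
qed

text \<open>The sequences \<open>j \<mapsto> p(j) F(q\<^sub>1 - jw) \<cdots> F(q\<^sub>n - jw) v\<close> with \<open>p\<close> a polynomial of degree less
  than \<open>d\<close> and \<open>v\<close> a vector that is killed by all \<open>E(p)\<close>, and their sums.\<close>

inductive lowering_seq :: "int^'n \<Rightarrow> nat \<Rightarrow> nat \<Rightarrow> (nat \<Rightarrow> 'v) \<Rightarrow> bool" for w where
  zero: "lowering_seq w n d (\<lambda>_. 0)"
| base: "(\<And>p. E p v = 0) \<Longrightarrow> i < d \<Longrightarrow> lowering_seq w 0 d (\<lambda>j. scale (of_nat j ^ i) v)"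
| F: "lowering_seq w n d g \<Longrightarrow> lowering_seq w (Suc n) d (\<lambda>j. F (q - int j *s w) (g j))"
| add: "lowering_seq w n d g \<Longrightarrow> lowering_seq w n d g' \<Longrightarrow> lowering_seq w n d (\<lambda>j. g j + g' j)"
| scale: "lowering_seq w n d g \<Longrightarrow> lowering_seq w n d (\<lambda>j. scale c (g j))"

lemma lowering_seq_mono: "lowering_seq w n d g \<Longrightarrow> d \<le> d' \<Longrightarrow> lowering_seq w n d' g"
  by (induction rule: lowering_seq.induct) (auto intro: lowering_seq.intros)

lemma lowering_seq_mult:
  "lowering_seq w n d g \<Longrightarrow> lowering_seq w n (Suc d) (\<lambda>j. scale (of_nat j) (g j))"
proof (induction rule: lowering_seq.induct)
  case (base v i d)
  then show ?case
    using lowering_seq.base[of v "Suc i" "Suc d" w] by simp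
next
  case (F n d g q)
  show ?case
    using lowering_seq.F[OF F.IH, of q] by (simp add: endo_scale[OF endo_F])
next
  case (add n d g g')
  show ?case
    using lowering_seq.add[OF add.IH] by (simp add: scale_right_distrib)
next
  case (scale n d g c)
  show ?case
    using lowering_seq.scale[OF scale.IH, of c] by (simp add: mult.commute)
qed (auto intro: lowering_seq.zero)

lemma lowering_seq_mult_power:
  "lowering_seq w n d g \<Longrightarrow> lowering_seq w n (m + d) (\<lambda>j. scale (of_nat j ^ m) (g j))"
  by (induction m) (auto dest: lowering_seq_mult)

lemma E_H_eq_0: "(\<And>p. E p v = 0) \<Longrightarrow> E p (H q v) = 0"
  using HE[of q p v] by (simp add: endo_0[OF endo_H])

lemma E_Z_eq_0: "(\<And>p. E p v = 0) \<Longrightarrow> E p (Z q k v) = 0"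
  using ZE[of q k p v] by (simp add: endo_0[OF endo_Z])

lemma lowering_seq_Z: "lowering_seq w n d g \<Longrightarrow> lowering_seq w n d (\<lambda>j. Z p k (g j))"
proof (induction rule: lowering_seq.induct)
  case (base v i d)
  then show ?case
    using lowering_seq.base[of "Z p k v" i d w] E_Z_eq_0 by (simp add: endo_scale[OF endo_Z])
qed (auto intro: lowering_seq.intros
    simp: endo_0[OF endo_Z] endo_add[OF endo_Z] endo_scale[OF endo_Z] ZF)

text \<open>Moving \<open>H p\<close> inward past a factor \<open>F\<close> only shifts the degree
  of that factor by \<open>p\<close>, and \<open>H p v\<close> is again killed by all
  \<open>E\<close>. So neither the number of factors nor the degree in \<open>j\<close>
  changes.\<close>

lemma lowering_seq_H: "lowering_seq w n d g \<Longrightarrow> lowering_seq w n d (\<lambda>j. H p (g j))"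
proof (induction rule: lowering_seq.induct)
  case (base v i d)
  then show ?case
    using lowering_seq.base[of "H p v" i d w] E_H_eq_0 by (simp add: endo_scale[OF endo_H])
next
  case (F n d g q)
  have *: "H p (F (q - int j *s w) (g j)) =
      F (q - int j *s w) (H p (g j)) + scale (- 2) (F (p + q - int j *s w) (g j))" for j
    by (simp add: HF algebra_simps)
  show ?case
    unfolding * by (intro lowering_seq.add lowering_seq.scale lowering_seq.F F)
qed (auto intro: lowering_seq.intros
    simp: endo_0[OF endo_H] endo_add[OF endo_H] endo_scale[OF endo_H])

lemma lowering_seq_0_E:
  assumes "lowering_seq w n d g" "n = 0"
  shows "E p (g j) = 0"
  using assms
  by (induction arbitrary: p rule: lowering_seq.induct)
    (auto simp: endo_0[OF endo_E] endo_add[OF endo_E] endo_scale[OF endo_E])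

text \<open>In the commutator of \<open>E (p + jw)\<close> with \<open>F (q - jw)\<close> the total
  degree \<open>p + q\<close> does not depend on \<open>j\<close>. One factor is lost, and the
  central term, affine in \<open>j\<close> by additivity of \<open>Z\<close>, raises the degree by
  at most one.\<close>

lemma lowering_seq_E:
  "lowering_seq w n d g \<Longrightarrow> lowering_seq w (n - 1) (Suc d) (\<lambda>j. E (p + int j *s w) (g j))"
proof (induction rule: lowering_seq.induct)
  case (base v i d)
  then show ?case by (auto intro: lowering_seq.zero simp: endo_scale[OF endo_E])
next
  case (F n d g q)
  have "E (p + int j *s w) (F (q - int j *s w) (g j)) =
      F (q - int j *s w) (E (p + int j *s w) (g j)) +
      (H (p + q) (g j) + (Z p (p + q) (g j) + scale (of_nat j) (Z w (p + q) (g j))))" for j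
    by (simp add: EF Z_add Z_mult add.assoc)
  moreover have "lowering_seq w n (Suc d) (\<lambda>j. F (q - int j *s w) (E (p + int j *s w) (g j)))"
  proof (cases n)
    \<comment> \<open>Here \<open>n - 1\<close> is truncated to 0, so prefixing \<open>F\<close> to
      the induction hypothesis would give one factor too many; the term is zero instead, because
      \<open>E\<close> kills \<open>g j\<close>.\<close>
    case 0
    then show ?thesis
      using lowering_seq_0_E[OF F.hyps] by (simp add: endo_0[OF endo_F] lowering_seq.zero)
  next
    case (Suc n')
    then show ?thesis using lowering_seq.F[OF F.IH, of q] by simp
  qed
  moreover have "lowering_seq w n (Suc d) (\<lambda>j. H (p + q) (g j) + (Z p (p + q) (g j) +
      scale (of_nat j) (Z w (p + q) (g j))))"
    by (intro lowering_seq.add lowering_seq_mult lowering_seq_H lowering_seq_Z F.hyps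
        lowering_seq_mono[OF F.hyps]) auto
  ultimately show ?case by (simp add: lowering_seq.add)
qed (auto intro: lowering_seq.intros
    simp: endo_0[OF endo_E] endo_add[OF endo_E] endo_scale[OF endo_E])

lemma lowering_seq_0_polynomial:
  assumes "lowering_seq w n d g" "n = 0"
  shows "\<exists>c. \<forall>j. g j = (\<Sum>i<d. scale (of_nat j ^ i) (c i))"
  using assms
proof (induction rule: lowering_seq.induct)
  case (zero n d)
  then show ?case by (intro exI[of _ "\<lambda>_. 0"]) simp
next
  case (base v i d)
  have "scale (of_nat j ^ i) v = (\<Sum>l<d. scale (of_nat j ^ l) (if l = i then v else 0))" for j
    using base(2) by (simp add: if_distrib[of "scale _"] cong: if_cong)
  then show ?case by (intro exI[of _ "\<lambda>l. if l = i then v else 0"]) blast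
next
  case (add n d g g')
  then obtain c c' where "\<And>j. g j = (\<Sum>i<d. scale (of_nat j ^ i) (c i))"
    "\<And>j. g' j = (\<Sum>i<d. scale (of_nat j ^ i) (c' i))" by metis
  then show ?case
    by (intro exI[of _ "\<lambda>i. c i + c' i"]) (simp add: scale_right_distrib sum.distrib)
next
  case (scale n d g a)
  then obtain c where "\<And>j. g j = (\<Sum>i<d. scale (of_nat j ^ i) (c i))" by metis
  then show ?case
    by (intro exI[of _ "\<lambda>i. scale a (c i)"]) (simp add: scale_sum_right mult.commute)
qed simp

section \<open>The leading term of \<open>E(jw)^m F(k - jw)^n v\<close> as a function of
  \<open>j\<close>\<close>

lemma lowering_seq_F_funpow:
  assumes "\<And>p. E p v = 0"
  shows "lowering_seq w n 1 (\<lambda>j. (F (k - int j *s w) ^^ n) v)"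
proof (induction n)
  case 0
  show ?case using lowering_seq.base[OF assms, of 0 1 w] by simp
qed (auto dest: lowering_seq.F)

text \<open>Each of the \<open>n\<close> factors contributes the same central term
  \<open>j Z w k\<close>, while the terms with \<open>H k\<close> have constant coefficients; the
  bound 1 on the degree of \<open>g\<close> says exactly this.\<close>

lemma E_F_funpow:
  assumes v: "\<And>p. E p v = 0"
  shows "\<exists>g. lowering_seq w (n - 1) 1 g \<and> (\<forall>j. E (int j *s w) ((F (k - int j *s w) ^^ n) v) =
    scale (of_nat (n * j)) ((F (k - int j *s w) ^^ (n - 1)) (Z w k v)) + g j)"
proof (induction n)
  case 0
  then show ?case using v by (intro exI[of _ "\<lambda>_. 0"]) (simp add: lowering_seq.zero)
next
  case (Suc n)
  let ?F = "\<lambda>j. F (k - int j *s w)"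
  have Z_F: "Z w k ((?F j ^^ n) v) = (?F j ^^ n) (Z w k v)" for j
    by (induction n) (simp_all add: ZF)
  have step: "E (int j *s w) ((?F j ^^ Suc n) v) = ?F j (E (int j *s w) ((?F j ^^ n) v)) +
      H k ((?F j ^^ n) v) + scale (of_nat j) ((?F j ^^ n) (Z w k v))" for j
    by (simp add: EF Z_mult Z_F)
  have H: "lowering_seq w n 1 (\<lambda>j. H k ((?F j ^^ n) v))"
    by (rule lowering_seq_H[OF lowering_seq_F_funpow[OF v]])
  show ?case
  proof (cases n)
    case 0
    then show ?thesis
      using H step by (intro exI[of _ "\<lambda>j. H k ((?F j ^^ n) v)"])
        (simp add: v endo_0[OF endo_F] add.commute)
  next
    case (Suc n')
    obtain g where g: "lowering_seq w n' 1 g" and Eg: "\<And>j. E (int j *s w) ((?F j ^^ n) v) =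
        scale (of_nat (n * j)) ((?F j ^^ n') (Z w k v)) + g j"
      using Suc.IH Suc by auto
    have "?F j (E (int j *s w) ((?F j ^^ n) v)) =
        scale (of_nat (n * j)) ((?F j ^^ n) (Z w k v)) + ?F j (g j)" for j
      unfolding Eg by (simp add: endo_add[OF endo_F] endo_scale[OF endo_F] Suc)
    then have "E (int j *s w) ((?F j ^^ Suc n) v) =
        scale (of_nat (Suc n * j)) ((?F j ^^ n) (Z w k v)) + (?F j (g j) + H k ((?F j ^^ n) v))" for j
      unfolding step by (simp add: scale_left_distrib algebra_simps)
    moreover have "lowering_seq w n 1 (\<lambda>j. ?F j (g j) + H k ((?F j ^^ n) v))"
      using lowering_seq.add[OF lowering_seq.F[OF g] H[unfolded Suc]] Suc by simp
    ultimately show ?thesis by (intro exI[of _ "\<lambda>j. ?F j (g j) + H k ((?F j ^^ n) v)"]) simp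
  qed
qed

text \<open>Every further \<open>E\<close> multiplies the leading coefficient by the number
  \<open>n - m\<close> of remaining factors and raises the degree in \<open>j\<close> by one, so
  \<open>c\<close> is a falling factorial.\<close>

lemma E_funpow_F_funpow:
  assumes v: "\<And>p. E p v = 0" and "m \<le> n"
  shows "\<exists>c g. c \<noteq> 0 \<and> lowering_seq w (n - m) m g \<and>
    (\<forall>j. (E (int j *s w) ^^ m) ((F (k - int j *s w) ^^ n) v) =
      scale (c * of_nat j ^ m) ((F (k - int j *s w) ^^ (n - m)) ((Z w k ^^ m) v)) + g j)"
  using assms(2)
proof (induction m)
  case 0
  then show ?case
    by (intro exI[of _ 1] exI[of _ "\<lambda>_. 0"]) (simp add: lowering_seq.zero)
next
  case (Suc m)
  let ?F = "\<lambda>j. F (k - int j *s w)"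
  obtain c g where c: "c \<noteq> 0" and g: "lowering_seq w (n - m) m g"
    and IH: "\<And>j. (E (int j *s w) ^^ m) ((?F j ^^ n) v) =
      scale (c * of_nat j ^ m) ((?F j ^^ (n - m)) ((Z w k ^^ m) v)) + g j"
    using Suc by auto
  have "E p ((Z w k ^^ m) v) = 0" for p
    by (induction m arbitrary: p) (auto simp: v E_Z_eq_0)
  from E_F_funpow[OF this, of w "n - m" k] obtain g' where
    g': "lowering_seq w (n - Suc m) 1 g'"
    and Eg': "\<And>j. E (int j *s w) ((?F j ^^ (n - m)) ((Z w k ^^ m) v)) =
      scale (of_nat ((n - m) * j)) ((?F j ^^ (n - Suc m)) ((Z w k ^^ Suc m) v)) + g' j"
    by auto
  \<comment> \<open>The lower terms have two sources: the remainder \<open>g'\<close> times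
    \<open>j^m\<close>, and the old remainder \<open>g\<close>, whose degree bound grows from
    \<open>m\<close> to \<open>Suc m\<close> under \<open>E\<close>.\<close>
  define g'' where
    "g'' = (\<lambda>j. scale c (scale (of_nat j ^ m) (g' j)) + E (0 + int j *s w) (g j))"
  have "lowering_seq w (n - Suc m) (Suc m) g''"
    unfolding g''_def
    using lowering_seq_mult_power[OF g', of m] lowering_seq_E[OF g, of 0]
    by (intro lowering_seq.add lowering_seq.scale) (simp_all add: diff_diff_eq)
  moreover have "(E (int j *s w) ^^ Suc m) ((?F j ^^ n) v) =
      scale (c * of_nat (n - m) * of_nat j ^ Suc m)
        ((?F j ^^ (n - Suc m)) ((Z w k ^^ Suc m) v)) + g'' j" for j
    by (simp add: IH Eg' g''_def endo_add[OF endo_E] endo_scale[OF endo_E] scale_right_distrib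
        mult_ac del: of_nat_diff)
  moreover have "c * of_nat (n - m) \<noteq> 0" using c Suc.prems by (simp del: of_nat_diff)
  ultimately show ?case by (intro exI[of _ "c * of_nat (n - m)"] exI[of _ g'']) blast
qed

text \<open>\<open>E(jw)\<^sup>N F(k - jw)\<^sup>N v\<close> is a polynomial in \<open>j\<close> whose coefficient at \<open>j\<^sup>N\<close> is a non-zero
  multiple of the \<open>N\<close>-th power of \<open>Z w k\<close> applied to \<open>v\<close>.\<close>

lemma Z_funpow_eq_0:
  assumes v: "\<And>p. E p v = 0" and F: "\<And>j. (F (k - int j *s w) ^^ N) v = 0"
  shows "(Z w k ^^ N) v = 0"
proof -
  obtain c g where c: "c \<noteq> 0" and g: "lowering_seq w 0 N g"
    and eq: "\<And>j. (E (int j *s w) ^^ N) ((F (k - int j *s w) ^^ N) v) =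
      scale (c * of_nat j ^ N) ((Z w k ^^ N) v) + g j"
    using E_funpow_F_funpow[of v N N w k] v by auto
  obtain b where b: "\<And>j. g j = (\<Sum>i<N. scale (of_nat j ^ i) (b i))"
    using lowering_seq_0_polynomial[OF g] by blast
  have "(\<Sum>i<N. scale (of_nat j ^ i) (b i)) + scale (of_nat j ^ N) (scale c ((Z w k ^^ N) v)) = 0"
    for j
    using eq[of j] F[of j] b[of j] endo_0[OF endo_funpow[OF endo_E]]
    by (simp add: mult.commute add.commute)
  then have "scale c ((Z w k ^^ N) v) = 0" by (rule leading_coefficient_eq_0)
  then show ?thesis using c by simp
qed

end

text \<open>\<open>M j q\<close> stands for a weight space: the height \<open>j\<close> counts steps
  along the root of \<open>e\<close>, and \<open>q\<close> is the degree shift.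
  \<open>level_0\<close> expresses that the \<open>K_i\<close> act by 0.\<close>

locale integrable_loop_sl2 = loop_sl2 scale E F H Z
  for scale :: "complex \<Rightarrow> 'v::ab_group_add \<Rightarrow> 'v" and E F H :: "int^'n::finite \<Rightarrow> 'v \<Rightarrow> 'v"
    and Z :: "int^'n \<Rightarrow> int^'n \<Rightarrow> 'v \<Rightarrow> 'v" +
  fixes M :: "int \<Rightarrow> int^'n \<Rightarrow> 'v set" and a :: complex
  assumes level_0: "Z p 0 v = 0"
    and subspace_M: "subspace (M j q)" and fin_dim_M: "fin_dim (M j q)"
    and E_M: "v \<in> M j q \<Longrightarrow> E p v \<in> M (j + 1) (q + p)"
    and F_M: "v \<in> M j q \<Longrightarrow> F p v \<in> M (j - 1) (q + p)"
    and H_M: "v \<in> M j q \<Longrightarrow> H 0 v = scale (a + 2 * of_int j) v"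
    and E_nilpotent: "\<exists>N. (E p ^^ N) v = 0" and F_nilpotent: "\<exists>N. (F p ^^ N) v = 0"
    and nonzero: "\<exists>v\<in>M 0 0. v \<noteq> 0"
begin

text \<open>Level zero enters here: \<open>E p\<close> and \<open>F (- p)\<close> have total degree
  0, where the central term vanishes. So every \<open>p\<close> gives a triple with the same
  \<open>H 0\<close>.\<close>

lemma sl2: "sl2_action scale (E p) (F (- p)) (H 0)"
  by unfold_locales (simp_all add: endo_E endo_F endo_H EF HE HF level_0)

lemma E_funpow_M: "v \<in> M j q \<Longrightarrow> (E 0 ^^ n) v \<in> M (j + int n) q"
proof (induction n)
  case (Suc n)
  from E_M[OF Suc.IH[OF Suc.prems], of 0] show ?case by (simp add: ac_simps)
qed simp

lemma F_funpow_M: "v \<in> M j q \<Longrightarrow> \<exists>q'. (F p ^^ n) v \<in> M (j - int n) q'"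
proof (induction n)
  case (Suc n)
  then obtain q' where "(F p ^^ n) v \<in> M (j - int n) q'" by blast
  from F_M[OF this, of p] show ?case by (auto simp: algebra_simps)
qed auto

section \<open>Weights and dimensions along the root string\<close>

lemma weight_integral: "\<exists>A. a = of_int A"
proof -
  obtain v where v: "v \<in> M 0 0" "v \<noteq> 0" using nonzero by blast
  obtain N where "(E 0 ^^ N) v = 0" using E_nilpotent by blast
  then obtain n where n: "(E 0 ^^ n) v \<noteq> 0" "E 0 ((E 0 ^^ n) v) = 0"
    using funpow_last_nonzero v(2) by blast
  interpret sl2_action scale "E 0" "F 0" "H 0" using sl2[of 0] by simp
  obtain N' where "(F 0 ^^ N') ((E 0 ^^ n) v) = 0" using F_nilpotent by blast
  from highest_weight[OF n(2) H_M[OF E_funpow_M[OF v(1)]] n(1) this]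
  obtain l where "a + 2 * of_int (0 + int n) = of_nat l" by blast
  then have "a = of_int (int l - 2 * int n)" by (simp add: eq_diff_eq)
  then show ?thesis by blast
qed

definition A :: int where "A = (SOME A. a = of_int A)"

lemma weight: "v \<in> M j q \<Longrightarrow> H 0 v = scale (of_int (A + 2 * j)) v"
  using H_M someI_ex[OF weight_integral] by (simp add: A_def)

text \<open>A non-zero \<open>v\<close> killed by \<open>F p\<close> would be a lowest weight vector
  for the triple of \<open>- p\<close>, so its weight would not be positive.\<close>

lemma F_injective:
  assumes "v \<in> M j q" "A + 2 * j > 0" "F p v = 0"
  shows "v = 0"
proof (rule ccontr)
  assume "v \<noteq> 0"
  interpret sl2_action scale "E (- p)" "F p" "H 0" using sl2[of "- p"] by simp
  obtain N where "(E (- p) ^^ N) v = 0" using E_nilpotent by blast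
  from lowest_weight[OF assms(3) weight[OF assms(1)] \<open>v \<noteq> 0\<close> this]
  obtain n where "(of_int (A + 2 * j) :: complex) = - of_nat n" by blast
  then have "(of_int (A + 2 * j) :: complex) = of_int (- int n)" by simp
  then show False using assms(2) unfolding of_int_eq_iff by linarith
qed

text \<open>The degree of the lowering operator is free, so \<open>F (q' - q)\<close> connects any
  two degrees \<open>q\<close> and \<open>q'\<close>; this makes the comparison uniform in the
  degree.\<close>

lemma dim_M_le:
  assumes "A + 2 * (j + 1) > 0"
  shows "dim (M (j + 1) q) \<le> dim (M j q')"
    and "dim (M (j + 1) q) = dim (M j q') \<Longrightarrow> M j q' \<subseteq> F (q' - q) ` M (j + 1) q"
proof -
  have F: "F (q' - q) v \<in> M j q'" if "v \<in> M (j + 1) q" for v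
    using F_M[OF that, of "q' - q"] by simp
  have ker: "v = 0" if "v \<in> M (j + 1) q" "F (q' - q) v = 0" for v
    using F_injective[OF that(1) assms that(2)] .
  show "dim (M (j + 1) q) \<le> dim (M j q')"
    by (rule dim_le_of_injective(1)[OF endo_F subspace_M fin_dim_M subspace_M fin_dim_M F ker])
  show "M j q' \<subseteq> F (q' - q) ` M (j + 1) q" if "dim (M (j + 1) q) = dim (M j q')"
    by (rule dim_le_of_injective(2)[OF endo_F subspace_M fin_dim_M subspace_M fin_dim_M F ker that])
qed

text \<open>The dimension of \<open>M j q\<close> does not increase with \<open>j\<close> once the weight \<open>A + 2j\<close> is positive,
  for level \<open>0\<close> uniformly in \<open>q\<close>. When it is constant and not zero, a highest weight vector lies
  in the image of \<open>F 0\<close>, and this generates an infinite string of non-zero vectors upwards.\<close>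

lemma ex_zero_M: "\<exists>j\<ge>J. \<forall>q. M j q \<subseteq> {0}"
proof (rule ccontr)
  assume "\<not> (\<exists>j\<ge>J. \<forall>q. M j q \<subseteq> {0})"
  then have non0: "\<exists>q. \<exists>v\<in>M j q. v \<noteq> 0" if "j \<ge> J" for j using that by blast
  define J' where "J' = max J (\<bar>A\<bar> + 1)"
  have pos: "A + 2 * j > 0" if "j \<ge> J'" for j using that unfolding J'_def by linarith
  define d where "d i = dim (M (J' + int i) 0)" for i
  have dle: "d (Suc i) \<le> d i" for i
    using dim_M_le(1)[of "J' + int i" 0 0] pos[of "J' + int i + 1"] by (simp add: d_def ac_simps)
  define i0 where "i0 = (ARG_MIN d i. True)"
  have min: "d i0 \<le> d i" for i unfolding i0_def by (rule arg_min_nat_le) simp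
  have const: "d (i0 + i) = d i0" for i
  proof (induction i)
    case (Suc i)
    then show ?case using dle[of "i0 + i"] min[of "i0 + Suc i"] by simp
  qed simp
  \<comment> \<open>Some degree \<open>q\<close> is non-zero one step higher; comparing dimensions
    across degrees carries this over to degree 0.\<close>
  obtain q v where "v \<in> M (J' + int i0 + 1) q" "v \<noteq> 0"
    using non0[of "J' + int i0 + 1"] by (force simp: J'_def)
  from dim_pos[OF fin_dim_M this] have "d i0 > 0"
    using dim_M_le(1)[of "J' + int i0" q 0] pos[of "J' + int i0 + 1"] by (simp add: d_def)
  then have "\<not> M (J' + int i0) 0 \<subseteq> {0}"
    using dim_le_card[of "M (J' + int i0) 0" "{}"] by (auto simp: d_def)
  then obtain u where u: "u \<in> M (J' + int i0) 0" "u \<noteq> 0" by blast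
  obtain N where "(E 0 ^^ N) u = 0" using E_nilpotent by blast
  then obtain n where n: "(E 0 ^^ n) u \<noteq> 0" "E 0 ((E 0 ^^ n) u) = 0"
    using funpow_last_nonzero u(2) by blast
  let ?j = "J' + int i0 + int n"
  have "dim (M (?j + 1) 0) = dim (M ?j 0)"
    using const[of n] const[of "Suc n"] by (simp add: d_def ac_simps)
  then have "M ?j 0 \<subseteq> F 0 ` M (?j + 1) 0"
    using dim_M_le(2)[of ?j 0 0] pos[of "?j + 1"] by simp
  then obtain x where x: "x \<in> M (?j + 1) 0" "(E 0 ^^ n) u = F 0 x"
    using E_funpow_M[OF u(1), of n] by auto
  interpret sl2_action scale "E 0" "F 0" "H 0" using sl2[of 0] by simp
  have "x \<noteq> 0" using n(1) x(2) endo_0[OF endo_f] by auto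
  moreover have "H 0 x = scale (of_nat (nat (A + 2 * (?j + 1)))) x"
    using weight[OF x(1)] pos[of "?j + 1"] by simp
  moreover have "nat (A + 2 * (?j + 1)) > 0" using pos[of "?j + 1"] by simp
  \<comment> \<open>The string starts with \<open>c = 0\<close> because \<open>F 0 x\<close> is a
    highest weight vector.\<close>
  moreover have "E 0 (F 0 x) = scale (- of_nat 0) x" using n(2) x(2) by simp
  ultimately have "(E 0 ^^ i) x \<noteq> 0" for i by (rule e_funpow_nonzero)
  then show False using E_nilpotent by blast
qed

text \<open>Above a height \<open>J\<close> that is zero in all degrees and has positive weight,
  \<open>F 0\<close> is injective and maps each height into the preceding one, so the vanishing
  propagates upwards.\<close>

lemma M_bounded_above: "\<exists>J\<ge>0. \<forall>j\<ge>J. \<forall>q. M j q \<subseteq> {0}"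
proof -
  obtain J where J: "J \<ge> \<bar>A\<bar> + 1" "\<And>q. M J q \<subseteq> {0}" using ex_zero_M by blast
  have "\<forall>q. M j q \<subseteq> {0}" if "j \<ge> J" for j
    using that
  proof (induction j rule: int_ge_induct)
    case (step j)
    show ?case
    proof (intro allI subsetI)
      fix q v assume v: "v \<in> M (j + 1) q"
      then have "F 0 v = 0" using F_M[OF v, of 0] step.IH by auto
      then show "v \<in> {0}" using F_injective[OF v] step.hyps J(1) by auto
    qed
  qed (use J in blast)
  then show ?thesis using J(1) by (intro exI[of _ J]) auto
qed

lemma ex_top: "\<exists>j q v. v \<in> M j q \<and> v \<noteq> 0 \<and> (\<forall>j'>j. \<forall>q. M j' q \<subseteq> {0})"
proof -
  obtain J where J: "J \<ge> 0" "\<And>j q. j \<ge> J \<Longrightarrow> M j q \<subseteq> {0}" using M_bounded_above by blast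
  \<comment> \<open>Heights are counted downwards from \<open>J\<close>; the least \<open>n\<close>
    gives the top height \<open>J - n\<close>, and \<open>P (nat J)\<close> holds because height 0
    is not zero.\<close>
  define P where "P n \<longleftrightarrow> (\<exists>q. \<not> M (J - int n) q \<subseteq> {0})" for n
  have "P (nat J)" using nonzero J(1) by (auto simp: P_def)
  then have P: "P (LEAST n. P n)" by (rule LeastI)
  define n where "n = (LEAST n. P n)"
  have "M j' q \<subseteq> {0}" if "j' > J - int n" for j' q
  proof (cases "j' \<ge> J")
    case False
    then have "\<not> P (nat (J - j'))"
      using that not_less_Least[of "nat (J - j')" P] by (auto simp: n_def)
    then show ?thesis using False by (auto simp: P_def)
  qed (use J in blast)
  moreover obtain q v where "v \<in> M (J - int n) q" "v \<noteq> 0"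
    using P unfolding P_def n_def by blast
  ultimately show ?thesis by blast
qed

text \<open>Going down by \<open>n\<close> steps from height \<open>i\<close> ends at a lowest
  weight vector. Its reflection is non-zero at height \<open>n - i - A\<close>, which exceeds
  \<open>j\<close>.\<close>

lemma M_bounded_below:
  assumes top: "\<And>j' q. j' > j \<Longrightarrow> M j' q \<subseteq> {0}" and "i + j + A < 0"
  shows "M i q \<subseteq> {0}"
proof (rule ccontr)
  assume "\<not> M i q \<subseteq> {0}"
  then obtain u where u: "u \<in> M i q" "u \<noteq> 0" by blast
  obtain N where "(F 0 ^^ N) u = 0" using F_nilpotent by blast
  then obtain n where n: "(F 0 ^^ n) u \<noteq> 0" "F 0 ((F 0 ^^ n) u) = 0"
    using funpow_last_nonzero u(2) by blast
  obtain q' where q': "(F 0 ^^ n) u \<in> M (i - int n) q'" using F_funpow_M[OF u(1)] by blast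
  interpret sl2_action scale "E 0" "F 0" "H 0" using sl2[of 0] by simp
  obtain N' where "(E 0 ^^ N') ((F 0 ^^ n) u) = 0" using E_nilpotent by blast
  from lowest_weight[OF n(2) weight[OF q'] n(1) this] obtain b where
    b: "(of_int (A + 2 * (i - int n)) :: complex) = - of_nat b" "(E 0 ^^ b) ((F 0 ^^ n) u) \<noteq> 0"
    by blast
  then have "(of_int (A + 2 * (i - int n)) :: complex) = of_int (- int b)" by simp
  then have "A + 2 * (i - int n) = - int b" unfolding of_int_eq_iff .
  then have "i - int n + int b > j" using assms(2) by presburger
  then show False using top E_funpow_M[OF q', of b] b(2) by blast
qed

text \<open>At the top height all \<open>E p\<close> kill \<open>v\<close>, and enough factors
  \<open>F\<close> lead below the reflected bound. So a power of \<open>Z w k\<close> kills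
  \<open>v\<close>, and the last non-zero iterate lies in the kernel.\<close>

lemma ex_Z_eq_0: "\<exists>v. v \<noteq> 0 \<and> Z w k v = 0"
proof -
  obtain j q v where v: "v \<in> M j q" "v \<noteq> 0" and top: "\<And>j' q. j' > j \<Longrightarrow> M j' q \<subseteq> {0}"
    using ex_top by blast
  \<comment> \<open>The smallest natural number exceeding \<open>A + 2j\<close>, so that height
    \<open>j - N\<close> satisfies the condition of \<open>M_bounded_below\<close>.\<close>
  define N where "N = nat (A + 2 * j) + 1"
  have "E p v = 0" for p using E_M[OF v(1), of p] top[of "j + 1"] by auto
  moreover have "(F (k - int l *s w) ^^ N) v = 0" for l
  proof -
    obtain q' where "(F (k - int l *s w) ^^ N) v \<in> M (j - int N) q'"
      using F_funpow_M[OF v(1)] by blast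
    moreover have "j - int N + j + A < 0" unfolding N_def by linarith
    ultimately show ?thesis using M_bounded_below[OF top] by blast
  qed
  ultimately have "(Z w k ^^ N) v = 0" by (rule Z_funpow_eq_0)
  then show ?thesis using funpow_last_nonzero v(2) by metis
qed

end

section \<open>The graded Lie torus\<close>

context lie_torus
begin

sublocale G: complex_space scale by unfold_locales

lemma bracket_zero_left [simp]: "bracket 0 y = 0"
  using bracket_scale_left[of 0 0 y] by simp

lemma bracket_zero_right [simp]: "bracket x 0 = 0"
  using bracket_scale_right[of x 0 0] by simp

lemma bracket_anticommute: "bracket x y = - bracket y x"
proof -
  have "bracket x y + bracket y x = 0"
    using bracket_self[of "x + y"] bracket_self[of x] bracket_self[of y]
    by (simp add: bracket_add_left bracket_add_right add.commute)
  then show ?thesis by (simp add: eq_neg_iff_add_eq_0)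
qed

lemma endo_bracket: "G.endo (bracket x)"
  by (simp add: G.endo_iff bracket_add_right bracket_scale_right)

lemma form_zero_left [simp]: "form 0 y = 0"
  using form_scale[of 0 0 y] by simp

lemma form_zero_right [simp]: "form y 0 = 0"
  using form_sym[of y 0] by simp

lemma form_add_right: "form z (x + y) = form z x + form z y"
  using form_add[of x y z] by (simp add: form_sym)

lemma form_scale_right: "form y (scale c x) = c * form y x"
  using form_scale[of c x y] by (simp add: form_sym)

lemma form_sum_right: "form y (\<Sum>i\<in>I. g i) = (\<Sum>i\<in>I. form y (g i))"
  by (induction I rule: infinite_finite_induct) (auto simp: form_add_right)

text \<open>Invariance makes \<open>bracket h\<close> skew for the form, so
  \<open>(a + b) (x|y) = 0\<close>.\<close>

lemma form_weights:
  assumes "bracket h x = scale a x" "bracket h y = scale b y" "a + b \<noteq> 0"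
  shows "form x y = 0"
proof -
  have "form (bracket h x) y = form (bracket y h) x"
    using form_invariant[of y h x] by (simp add: form_sym)
  also have "bracket y h = scale (- b) y"
    using bracket_anticommute[of y h] assms(2) by simp
  finally have "(a + b) * form x y = 0"
    using assms(1) form_sym[of x y] by (simp only: form_scale) (simp add: algebra_simps)
  then show ?thesis using assms(3) by simp
qed

section \<open>The automorphisms and their fixed algebra \<open>grade 0\<close>\<close>

lemma endo_\<sigma>: "G.endo (\<sigma> i)"
  using \<sigma>_automorphism[of i] by (simp add: automorphism_def G.endo_def)

lemma \<sigma>_form: "form (\<sigma> i x) (\<sigma> i y) = form x y"
  using \<sigma>_automorphism by (rule form_automorphism)

lemma \<sigma>_commute': "\<sigma> i (\<sigma> j x) = \<sigma> j (\<sigma> i x)"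
  using \<sigma>_commute[of i j] by (metis comp_apply)

lemma grade_0_iff: "x \<in> grade 0 \<longleftrightarrow> (\<forall>i. \<sigma> i x = x)"
  by (simp add: grade_def)

lemma grade_\<Gamma>:
  assumes "k \<in> \<Gamma>"
  shows "grade k = grade 0"
proof -
  have "\<xi> i powi (k $ i) = 1" for i
  proof -
    from assms obtain l where "k $ i = int (m i) * l" unfolding \<Gamma>_def by blast
    then show ?thesis by (simp add: power_int_mult \<xi>_primitive(1))
  qed
  then show ?thesis by (simp add: grade_def)
qed

lemma subspace_grade_0: "subspace (grade 0)"
  using grade_0(2) by (simp add: simple_def subalgebra_def)

lemma bracket_grade_0: "x \<in> grade 0 \<Longrightarrow> y \<in> grade 0 \<Longrightarrow> bracket x y \<in> grade 0"
  using grade_0(2) by (simp add: simple_def subalgebra_def)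

lemma \<hh>_subset: "\<hh> \<subseteq> grade 0"
  using grade_0(3) by (simp add: cartan_subalgebra_def)

lemma subspace_\<hh>: "subspace \<hh>"
  using grade_0(3) by (simp add: cartan_subalgebra_def nilpotent_def subalgebra_def)

lemma normalizer_\<hh>: "x \<in> grade 0 \<Longrightarrow> (\<And>h. h \<in> \<hh> \<Longrightarrow> bracket x h \<in> \<hh>) \<Longrightarrow> x \<in> \<hh>"
  using grade_0(3) unfolding cartan_subalgebra_def by blast

text \<open>Averaging over the powers of \<open>\<sigma> i\<close> does not change the pairing with \<open>\<gg>\<^sub>0\<close>.\<close>

lemma form_average:
  assumes "finite I"
  shows "\<exists>y'. (\<forall>i\<in>I. \<sigma> i y' = y') \<and> (\<forall>x\<in>grade 0. form x y' = form x y)"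
  using assms
proof (induction I rule: finite_induct)
  case (insert i I)
  then obtain y' where y': "\<And>i. i \<in> I \<Longrightarrow> \<sigma> i y' = y'" "\<And>x. x \<in> grade 0 \<Longrightarrow> form x y' = form x y"
    by blast
  define s where "s = (\<Sum>j<m i. (\<sigma> i ^^ j) y')"
  have "\<sigma> i s = (\<Sum>j<m i. (\<sigma> i ^^ Suc j) y')"
    by (simp add: s_def G.endo_sum[OF endo_\<sigma>])
  also have "\<dots> = (\<Sum>j<Suc (m i). (\<sigma> i ^^ j) y') - y'"
    by (subst sum.lessThan_Suc_shift) simp
  also have "\<dots> = s" by (simp add: s_def \<sigma>_order(2))
  finally have si: "\<sigma> i s = s" .
  have sl: "\<sigma> l s = s" if "l \<in> I" for l
  proof -
    have "\<sigma> l ((\<sigma> i ^^ j) y') = (\<sigma> i ^^ j) y'" for j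
      by (induction j) (auto simp: y'(1)[OF that] \<sigma>_commute'[of l i])
    then show ?thesis by (simp add: s_def G.endo_sum[OF endo_\<sigma>])
  qed
  have "form x s = of_nat (m i) * form x y" if x: "x \<in> grade 0" for x
  proof -
    have "form x ((\<sigma> i ^^ j) y') = form x y" for j
    proof (induction j)
      case (Suc j)
      have "form x ((\<sigma> i ^^ Suc j) y') = form (\<sigma> i x) (\<sigma> i ((\<sigma> i ^^ j) y'))"
        using x by (simp add: grade_0_iff)
      then show ?case using Suc by (simp only: \<sigma>_form)
    qed (simp add: y'(2)[OF x])
    then show ?thesis by (simp add: s_def form_sum_right)
  qed
  then show ?case
    using si sl \<sigma>_order(1)[of i]
    by (intro exI[of _ "scale (1 / of_nat (m i)) s"])
      (auto simp: G.endo_scale[OF endo_\<sigma>] form_scale_right)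
qed auto

lemma form_nondegenerate_grade_0:
  assumes "x \<in> grade 0" "x \<noteq> 0"
  shows "\<exists>y\<in>grade 0. form x y \<noteq> 0"
proof -
  obtain y where "form x y \<noteq> 0" using assms(2) form_nondegenerate by blast
  moreover obtain y' where "y' \<in> grade 0" "form x y' = form x y"
    using form_average[of UNIV y] assms(1) by (auto simp: grade_0_iff)
  ultimately show ?thesis by metis
qed

section \<open>Brackets, central terms and weights in the graded Lie torus\<close>

lemma zero_\<Gamma>: "0 \<in> \<Gamma>" by (simp add: \<Gamma>_def)

lemma add_\<Gamma>: "k \<in> \<Gamma> \<Longrightarrow> l \<in> \<Gamma> \<Longrightarrow> k + l \<in> \<Gamma>"
  by (simp add: \<Gamma>_def)

lemma lookup_map_scale [simp]:
  "Poly_Mapping.lookup (Poly_Mapping.map (scale c) f) k = scale c (Poly_Mapping.lookup f k)"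
  by (auto simp: Poly_Mapping.map.rep_eq when_def)

lemma lookup_degree_act [simp]:
  "Poly_Mapping.lookup (degree_act d f) k = scale (pairing d k) (Poly_Mapping.lookup f k)"
  by (auto simp: degree_act_def lookup_mapp when_def in_keys_iff)

lemma pairing_zero_left [simp]: "pairing 0 k = 0"
  by (simp add: pairing_def)

lemma pairing_zero_right [simp]: "pairing d 0 = 0"
  by (simp add: pairing_def)

lemma pairing_add: "pairing d (k + l) = pairing d k + pairing d l"
  by (simp add: pairing_def algebra_simps sum.distrib)

lemma degree_act_zero_left [simp]: "degree_act 0 f = 0"
  by (rule poly_mapping_eqI) simp

lemma degree_act_zero_right [simp]: "degree_act d 0 = 0"
  by (rule poly_mapping_eqI) simp

lemma degree_act_single:
  "degree_act d (Poly_Mapping.single k x) = Poly_Mapping.single k (scale (pairing d k) x)"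
  by (rule poly_mapping_eqI) (simp add: lookup_single when_def)

lemma sdegree_add: "sdegree d (z + w) = sdegree d z + sdegree d w" for d :: "complex^'n"
proof -
  have fdegree: "fdegree d (a + b) = fdegree d a + fdegree d b" for d :: "complex^'n" and a b
    by (rule poly_mapping_eqI) (simp add: lookup_add algebra_simps)
  show ?thesis by transfer (simp add: fdegree symbol_relations_def fs.span_zero)
qed

lemma sdegree_scale: "sdegree d (sscale c z) = sscale c (sdegree d z)" for d :: "complex^'n"
proof -
  have fdegree: "fdegree d (fscale c a) = fscale c (fdegree d a)" for d :: "complex^'n" and c a
    by (rule poly_mapping_eqI) simp
  show ?thesis by transfer (simp add: fdegree symbol_relations_def fs.span_zero)
qed

lemma sdegree_zero_right [simp]: "sdegree d 0 = 0" for d :: "complex^'n"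
  using sdegree_scale[of d 0 0] by simp

lemma sdegree_sum: "sdegree d (\<Sum>i\<in>I. g i) = (\<Sum>i\<in>I. sdegree d (g i))" for d :: "complex^'n"
  by (induction I rule: infinite_finite_induct) (auto simp: sdegree_add)

lemma sdegree_zero_left [simp]: "sdegree 0 z = 0" for z :: "'n symbol_space"
proof -
  have fdegree: "fdegree 0 a = 0" for a
    by (rule poly_mapping_eqI) simp
  show ?thesis by transfer (simp add: fdegree symbol_relations_def fs.span_zero)
qed

lemma sdegree_tK: "sdegree d (tK k i) = sscale (pairing d k) (tK k i)" for d :: "complex^'n"
proof -
  have fdegree: "fdegree d (Poly_Mapping.single (k, i) 1) = fscale (pairing d k) (Poly_Mapping.single (k, i) 1)"
    for d :: "complex^'n" and k i
    by (rule poly_mapping_eqI) (auto simp: lookup_single when_def)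
  show ?thesis by transfer (simp add: fdegree symbol_relations_def fs.span_zero)
qed

text \<open>The central term of \<open>[x(p), y(k - p)]\<close> is \<open>(x|y)\<close> times \<open>ctr p k\<close>.\<close>

definition ctr :: "int^'n \<Rightarrow> int^'n \<Rightarrow> 'n symbol_space" where
  "ctr p k = (\<Sum>i\<in>UNIV. sscale (of_int (p $ i)) (tK k i))"

lemma ctr_add: "ctr (p + q) k = ctr p k + ctr q k"
  by (simp add: ctr_def ss.scale_left_distrib sum.distrib)

lemma ctr_zero [simp]: "ctr 0 k = 0"
  by (simp add: ctr_def)

lemma sdegree_ctr: "sdegree d (ctr p k) = sscale (pairing d k) (ctr p k)"
  by (simp add: ctr_def sdegree_sum sdegree_scale sdegree_tK ss.scale_sum_right mult.commute)

lemma tK_\<Z>: "k \<in> \<Gamma> \<Longrightarrow> tK k i \<in> \<Z>"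
  unfolding \<Z>_def by (rule ss.span_base) blast

lemma zero_\<Z>: "0 \<in> \<Z>"
  unfolding \<Z>_def by (rule ss.span_zero)

lemma add_\<Z>: "z \<in> \<Z> \<Longrightarrow> w \<in> \<Z> \<Longrightarrow> z + w \<in> \<Z>"
  unfolding \<Z>_def by (rule ss.span_add)

lemma scale_\<Z>: "z \<in> \<Z> \<Longrightarrow> sscale c z \<in> \<Z>"
  unfolding \<Z>_def by (rule ss.span_scale)

lemma ctr_\<Z>: "k \<in> \<Gamma> \<Longrightarrow> ctr p k \<in> \<Z>"
  unfolding ctr_def \<Z>_def by (intro ss.span_sum ss.span_scale) (auto intro: ss.span_base)

lemma span_tK_0_\<Z>: "ss.span (range (tK 0)) \<subseteq> \<Z>"
  unfolding \<Z>_def using zero_\<Gamma> by (intro ss.span_mono) auto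

lemma loop_bracket_single:
  "loop_bracket (Poly_Mapping.single k x) (Poly_Mapping.single l y) =
    Poly_Mapping.single (k + l) (bracket x y)"
  by (simp add: loop_bracket_def)

lemma loop_bracket_zero [simp]: "loop_bracket 0 f = 0" "loop_bracket f 0 = 0"
  by (simp_all add: loop_bracket_def)

lemma cocycle_single:
  "cocycle (Poly_Mapping.single k x) (Poly_Mapping.single l y) = sscale (form x y) (ctr k (k + l))"
  by (simp add: cocycle_def ctr_def)

lemma cocycle_zero [simp]: "cocycle 0 f = 0" "cocycle f 0 = 0"
  by (simp_all add: cocycle_def)

lemma loop_elem_LT_ext: "x \<in> grade k \<Longrightarrow> loop_elem x k \<in> LT_ext"
  by (simp add: loop_elem_def LT_ext_def LT_def lookup_single when_def zero_\<Z> grade_def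
      G.endo_0[OF endo_\<sigma>])

lemma central_elem_LT_ext: "z \<in> \<Z> \<Longrightarrow> central_elem z \<in> LT_ext"
  by (simp add: central_elem_def LT_ext_def LT_def grade_def G.endo_0[OF endo_\<sigma>])

lemma \<hh>_ext_LT_ext: "X \<in> \<hh>_ext \<Longrightarrow> X \<in> LT_ext"
  using \<hh>_subset span_tK_0_\<Z>
  by (auto simp: \<hh>_ext_def LT_ext_def LT_def lookup_single when_def grade_def
      G.endo_0[OF endo_\<sigma>])

lemma loop_elem_\<hh>_ext: "h \<in> \<hh> \<Longrightarrow> loop_elem h 0 \<in> \<hh>_ext"
  by (simp add: loop_elem_def \<hh>_ext_def ss.span_zero)

lemma loop_elem_add: "loop_elem (x + y) k = loop_elem x k + loop_elem y k"
  by (simp add: loop_elem_def single_add)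

lemma ext_scale_loop_elem: "ext_scale c (loop_elem x k) = loop_elem (scale c x) k"
  by (auto simp: loop_elem_def ext_scale_def lookup_single when_def intro!: poly_mapping_eqI)

lemma central_elem_add: "central_elem (z + w) = central_elem z + central_elem w"
  by (simp add: central_elem_def)

lemma ext_scale_central_elem: "ext_scale c (central_elem z) = central_elem (sscale c z)"
  by (auto simp: central_elem_def ext_scale_def intro!: poly_mapping_eqI)

lemma ext_bracket_loop_elem:
  "ext_bracket (loop_elem x k) (loop_elem y l) =
    loop_elem (bracket x y) (k + l) + central_elem (sscale (form x y) (ctr k (k + l)))"
  by (simp add: ext_bracket_def loop_elem_def central_elem_def loop_bracket_single cocycle_single)

lemma ext_bracket_central_elem:
  "ext_bracket X (central_elem z) = central_elem (sdegree (snd (snd X)) z)"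
  by (simp add: ext_bracket_def central_elem_def split: prod.split)

lemma ext_bracket_weight:
  assumes "x \<in> grade_weight \<hh> k \<alpha>" "X \<in> \<hh>_ext"
  shows "ext_bracket X (loop_elem x k) =
    ext_scale (\<alpha> (Poly_Mapping.lookup (fst X) 0) + pairing (snd (snd X)) k) (loop_elem x k)"
proof -
  obtain h z d where X: "X = (Poly_Mapping.single 0 h, z, d)" "h \<in> \<hh>"
    using assms(2) by (auto simp: \<hh>_ext_def)
  then have "bracket h x = scale (\<alpha> h) x"
    using assms(1) by (auto simp: grade_weight_def)
  then show ?thesis
    unfolding ext_scale_loop_elem
    by (simp add: X ext_bracket_def loop_elem_def loop_bracket_single cocycle_single
        degree_act_single scale_left_distrib single_add)
qed

lemma vector_space_ext_scale: "vector_space ext_scale"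
  by unfold_locales
    (auto simp: ext_scale_def scale_right_distrib scale_left_distrib ss.scale_right_distrib
      ss.scale_left_distrib lookup_add vec.scale_right_distrib vec.scale_left_distrib
      intro!: poly_mapping_eqI)

lemma ext_dual_iff:
  "\<mu> \<in> ext_dual \<longleftrightarrow> (\<forall>x\<in>\<hh>_ext. \<forall>y\<in>\<hh>_ext. \<mu> (x + y) = \<mu> x + \<mu> y) \<and>
     (\<forall>c. \<forall>x\<in>\<hh>_ext. \<mu> (ext_scale c x) = c * \<mu> x) \<and> (\<forall>x. x \<notin> \<hh>_ext \<longrightarrow> \<mu> x = 0)"
  by (simp add: ext_dual_def vector_space.dual_def[OF vector_space_ext_scale])

lemma \<hh>_ext_add: "X \<in> \<hh>_ext \<Longrightarrow> Y \<in> \<hh>_ext \<Longrightarrow> X + Y \<in> \<hh>_ext"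
  by (auto simp: \<hh>_ext_def single_add[symmetric] ss.span_add subspace_add[OF subspace_\<hh>])

lemma \<hh>_ext_scale: "X \<in> \<hh>_ext \<Longrightarrow> ext_scale c X \<in> \<hh>_ext"
proof -
  have "Poly_Mapping.map (scale c) (Poly_Mapping.single 0 h) = Poly_Mapping.single 0 (scale c h)"
    for h
    by (rule poly_mapping_eqI) (simp add: lookup_single when_def)
  then show "X \<in> \<hh>_ext \<Longrightarrow> ext_scale c X \<in> \<hh>_ext"
    by (auto simp: \<hh>_ext_def ext_scale_def ss.span_scale subspace_scale[OF subspace_\<hh>])
qed

text \<open>These are the weights reached from \<open>\<mu>\<close> by \<open>j\<close> steps along
  \<open>\<alpha>\<close> and a degree shift \<open>q\<close>. The value 0 off
  \<open>\<hh>_ext\<close> follows the convention of \<open>dual\<close>.\<close>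

lemma ext_dual_shift:
  assumes "\<mu> \<in> ext_dual" "\<alpha> \<in> dual \<hh>"
  shows "(\<lambda>X. if X \<in> \<hh>_ext then \<mu> X + of_int j * \<alpha> (Poly_Mapping.lookup (fst X) 0) +
    pairing (snd (snd X)) q else 0) \<in> ext_dual"
proof -
  have h: "Poly_Mapping.lookup (fst X) 0 \<in> \<hh>" if "X \<in> \<hh>_ext" for X
    using that by (auto simp: \<hh>_ext_def)
  have ext_scale: "Poly_Mapping.lookup (fst (ext_scale c X)) 0 = scale c (Poly_Mapping.lookup (fst X) 0)"
    "snd (snd (ext_scale c X)) = c *s snd (snd X)" for c X
    by (simp_all add: ext_scale_def split: prod.split)
  have "pairing (d + e) q = pairing d q + pairing e q" "pairing (c *s d) q = c * pairing d q" for c d e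
    by (simp_all add: pairing_def algebra_simps sum.distrib sum_distrib_left)
  then show ?thesis
    using assms h unfolding ext_dual_iff
    by (auto simp: dual_def \<hh>_ext_add \<hh>_ext_scale lookup_add algebra_simps ext_scale)
qed

text \<open>An isomorphism \<open>\<int>\<^sup>n \<rightarrow> \<Gamma>\<close>.\<close>

definition rescale :: "int^'n \<Rightarrow> int^'n" where
  "rescale p = (\<chi> i. int (m i) * p $ i)"

lemma rescale_\<Gamma>: "rescale p \<in> \<Gamma>"
  by (simp add: rescale_def \<Gamma>_def)

lemma rescale_add: "rescale (p + q) = rescale p + rescale q"
  by (simp add: rescale_def vec_eq_iff algebra_simps)

lemma rescale_zero [simp]: "rescale 0 = 0"
  by (simp add: rescale_def vec_eq_iff)

lemma rescale_surj: "k \<in> \<Gamma> \<Longrightarrow> \<exists>p. k = rescale p"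
  by (rule exI[of _ "\<chi> i. k $ i div int (m i)"]) (simp add: rescale_def \<Gamma>_def vec_eq_iff)

end

section \<open>Modules over the graded Lie torus\<close>

locale lie_torus_module = lie_torus scale bracket form \<sigma> m \<xi> \<hh>
  for scale :: "complex \<Rightarrow> 'g::ab_group_add \<Rightarrow> 'g" and bracket :: "'g \<Rightarrow> 'g \<Rightarrow> 'g"
    and form :: "'g \<Rightarrow> 'g \<Rightarrow> complex"
    and \<sigma> :: "'n::finite \<Rightarrow> 'g \<Rightarrow> 'g" and m :: "'n \<Rightarrow> nat" and \<xi> :: "'n \<Rightarrow> complex"
    and \<hh> :: "'g set" +
  fixes scaleV :: "complex \<Rightarrow> 'v::ab_group_add \<Rightarrow> 'v"
    and \<rho> :: "(int^'n \<Rightarrow>\<^sub>0 'g) \<times> 'n symbol_space \<times> (complex^'n) \<Rightarrow> 'v \<Rightarrow> 'v"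
  assumes ext_module: "ext_module scaleV \<rho>"
    and irreducible: "irreducible_module scaleV \<rho>"
    and integrable: "integrable_module scaleV \<rho>"
    and K_trivial: "\<rho> (central_elem (tK 0 i)) v = 0"
begin

sublocale V: complex_space scaleV
  using ext_module
  by (auto simp: ext_module_def lie_module_def intro: complex_space.intro)

section \<open>The operators of loop elements and central elements\<close>

lemma endo_\<rho>: "X \<in> LT_ext \<Longrightarrow> V.endo (\<rho> X)"
  and \<rho>_add: "X \<in> LT_ext \<Longrightarrow> Y \<in> LT_ext \<Longrightarrow> \<rho> (X + Y) v = \<rho> X v + \<rho> Y v"
  and \<rho>_scale: "X \<in> LT_ext \<Longrightarrow> \<rho> (ext_scale c X) v = scaleV c (\<rho> X v)"
  and \<rho>_bracket: "X \<in> LT_ext \<Longrightarrow> Y \<in> LT_ext \<Longrightarrow>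
    \<rho> (ext_bracket X Y) v = \<rho> X (\<rho> Y v) - \<rho> Y (\<rho> X v)"
  using ext_module by (auto simp: ext_module_def lie_module_def V.endo_def)

abbreviation L :: "'g \<Rightarrow> int^'n \<Rightarrow> 'v \<Rightarrow> 'v" where
  "L x k \<equiv> \<rho> (loop_elem x k)"

abbreviation C :: "'n symbol_space \<Rightarrow> 'v \<Rightarrow> 'v" where
  "C z \<equiv> \<rho> (central_elem z)"

lemma loop_elem_LT_ext': "x \<in> grade 0 \<Longrightarrow> k \<in> \<Gamma> \<Longrightarrow> loop_elem x k \<in> LT_ext"
  using loop_elem_LT_ext grade_\<Gamma> by auto

lemma endo_L: "x \<in> grade 0 \<Longrightarrow> k \<in> \<Gamma> \<Longrightarrow> V.endo (L x k)"
  by (rule endo_\<rho>[OF loop_elem_LT_ext'])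

lemma endo_C: "z \<in> \<Z> \<Longrightarrow> V.endo (C z)"
  by (rule endo_\<rho>[OF central_elem_LT_ext])

lemma L_add: "x \<in> grade 0 \<Longrightarrow> y \<in> grade 0 \<Longrightarrow> k \<in> \<Gamma> \<Longrightarrow> L (x + y) k v = L x k v + L y k v"
  by (simp add: loop_elem_add \<rho>_add loop_elem_LT_ext')

lemma L_scale: "x \<in> grade 0 \<Longrightarrow> k \<in> \<Gamma> \<Longrightarrow> L (scale c x) k v = scaleV c (L x k v)"
  by (simp add: \<rho>_scale loop_elem_LT_ext' flip: ext_scale_loop_elem)

lemma L_zero: "k \<in> \<Gamma> \<Longrightarrow> L 0 k v = 0"
  using L_scale[of 0 k 0 v] subspace_0[OF subspace_grade_0] by simp

lemma C_add: "z \<in> \<Z> \<Longrightarrow> w \<in> \<Z> \<Longrightarrow> C (z + w) v = C z v + C w v"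
  by (simp add: central_elem_add \<rho>_add central_elem_LT_ext)

lemma C_scale: "z \<in> \<Z> \<Longrightarrow> C (sscale c z) v = scaleV c (C z v)"
  by (simp add: \<rho>_scale central_elem_LT_ext flip: ext_scale_central_elem)

lemma C_zero [simp]: "C 0 v = 0"
  using C_scale[of 0 0 v] zero_\<Z> by simp

lemma C_sum: "(\<And>i. i \<in> I \<Longrightarrow> g i \<in> \<Z>) \<Longrightarrow> C (\<Sum>i\<in>I. g i) v = (\<Sum>i\<in>I. C (g i) v)"
proof (induction I rule: infinite_finite_induct)
  case (insert i I)
  then have "(\<Sum>i\<in>I. g i) \<in> \<Z>" unfolding \<Z>_def by (intro ss.span_sum) auto
  then show ?case using insert by (simp add: C_add)
qed auto

lemma L_L:
  assumes "x \<in> grade 0" "y \<in> grade 0" "k \<in> \<Gamma>" "l \<in> \<Gamma>"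
  shows "L x k (L y l v) =
    L y l (L x k v) + L (bracket x y) (k + l) v + C (sscale (form x y) (ctr k (k + l))) v"
  using \<rho>_bracket[of "loop_elem x k" "loop_elem y l" v] assms
  by (simp add: ext_bracket_loop_elem \<rho>_add loop_elem_LT_ext' central_elem_LT_ext bracket_grade_0
      add_\<Gamma> scale_\<Z> ctr_\<Z> algebra_simps)

lemma L_0_L:
  assumes "x \<in> grade 0" "y \<in> grade 0" "l \<in> \<Gamma>"
  shows "L x 0 (L y l v) = L y l (L x 0 v) + L (bracket x y) l v"
  using L_L[OF assms(1,2) zero_\<Gamma> assms(3)] by simp

lemma C_L:
  assumes "z \<in> \<Z>" "x \<in> grade 0" "k \<in> \<Gamma>"
  shows "C z (L x k v) = L x k (C z v)"
  using \<rho>_bracket[OF loop_elem_LT_ext'[OF assms(2,3)] central_elem_LT_ext[OF assms(1)], of v]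
  by (simp add: ext_bracket_central_elem loop_elem_def)

text \<open>The bracket of any element with a homogeneous \<open>z\<close> is a multiple of
  \<open>z\<close>, so the kernel of \<open>z\<close> is a submodule.\<close>

lemma central_zero_or_injective:
  assumes z: "z \<in> \<Z>" "\<And>d. sdegree d z = sscale (pairing d k) z" and v: "v \<noteq> 0" "C z v = 0"
  shows "C z w = 0"
proof -
  have "\<rho> X u \<in> {u. C z u = 0}" if X: "X \<in> LT_ext" and u: "C z u = 0" for X u
  proof -
    have "\<rho> X (C z u) - C z (\<rho> X u) = C (sdegree (snd (snd X)) z) u"
      using \<rho>_bracket[OF X central_elem_LT_ext[OF z(1)], of u] by (simp add: ext_bracket_central_elem)
    then show ?thesis
      using u z V.endo_0[OF endo_\<rho>[OF X]] by (simp add: C_scale)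
  qed
  moreover have "V.subspace {u. C z u = 0}"
    using endo_C[OF z(1)] by (simp add: V.subspace_def V.endo_0 V.endo_add V.endo_scale)
  ultimately have "{u. C z u = 0} = {0} \<or> {u. C z u = 0} = UNIV"
    using irreducible unfolding irreducible_module_def V.irreducible_under_def by blast
  then show ?thesis using v by blast
qed

section \<open>The weight space decomposition\<close>

lemma weight_decomposition_ex1:
  "\<exists>!f. Poly_Mapping.keys f \<subseteq> ext_dual \<and>
    (\<forall>\<mu>\<in>ext_dual. Poly_Mapping.lookup f \<mu> \<in> weight_space scaleV \<rho> \<mu>) \<and>
    v = (\<Sum>\<mu>\<in>Poly_Mapping.keys f. Poly_Mapping.lookup f \<mu>)"
proof -
  have "\<forall>v\<in>UNIV. \<exists>!f. Poly_Mapping.keys f \<subseteq> ext_dual \<and>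
      (\<forall>\<mu>\<in>ext_dual. Poly_Mapping.lookup f \<mu> \<in> weight_space scaleV \<rho> \<mu>) \<and>
      v = (\<Sum>\<mu>\<in>Poly_Mapping.keys f. Poly_Mapping.lookup f \<mu>)"
    using integrable unfolding integrable_module_def V.direct_sum_of_def by (elim conjE)
  from bspec[OF this UNIV_I] show ?thesis .
qed

lemmas weight_decomposition = ex1_implies_ex[OF weight_decomposition_ex1]

lemma weight_decomposition_unique:
  assumes "finite I" "I \<subseteq> ext_dual" "\<And>\<mu>. \<mu> \<in> I \<Longrightarrow> g \<mu> \<in> weight_space scaleV \<rho> \<mu>"
    and "(\<Sum>\<mu>\<in>I. g \<mu>) = 0" and "\<mu> \<in> I"
  shows "g \<mu> = 0"
proof -
  have ws0: "0 \<in> weight_space scaleV \<rho> \<mu>" for \<mu>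
    by (simp add: weight_space_def V.endo_0 endo_\<rho> \<hh>_ext_LT_ext)
  define f where "f = (\<Sum>\<mu>\<in>I. Poly_Mapping.single \<mu> (g \<mu>))"
  have f: "Poly_Mapping.lookup f \<mu> = (if \<mu> \<in> I then g \<mu> else 0)" for \<mu>
    using assms(1) by (simp add: f_def lookup_sum lookup_single when_def)
  have keys: "Poly_Mapping.keys f \<subseteq> I" by (auto simp: in_keys_iff f split: if_splits)
  have "(\<Sum>\<mu>\<in>Poly_Mapping.keys f. Poly_Mapping.lookup f \<mu>) = (\<Sum>\<mu>\<in>I. g \<mu>)"
    using keys assms(1) by (intro sum.mono_neutral_cong_left) (auto simp: f in_keys_iff)
  moreover define P where "P f \<longleftrightarrow> Poly_Mapping.keys f \<subseteq> ext_dual \<and>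
      (\<forall>\<mu>\<in>ext_dual. Poly_Mapping.lookup f \<mu> \<in> weight_space scaleV \<rho> \<mu>) \<and>
      0 = (\<Sum>\<mu>\<in>Poly_Mapping.keys f. Poly_Mapping.lookup f \<mu>)"
    for f :: "((int^'n \<Rightarrow>\<^sub>0 'g) \<times> 'n symbol_space \<times> (complex^'n) \<Rightarrow> complex) \<Rightarrow>\<^sub>0 'v"
  ultimately have "P f" using assms keys f ws0 by auto
  moreover have "P 0" using ws0 by (simp add: P_def)
  moreover have "\<exists>!f. P f" unfolding P_def by (rule weight_decomposition_ex1)
  ultimately have "f = 0" by blast
  then show ?thesis using f[of \<mu>] assms(5) by simp
qed

lemma \<rho>_weight_space:
  "X \<in> \<hh>_ext \<Longrightarrow> v \<in> weight_space scaleV \<rho> \<mu> \<Longrightarrow> \<rho> X v = scaleV (\<mu> X) v"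
  by (simp add: weight_space_def)

lemma eq_0_on_weight_spaces:
  assumes "V.endo f" "\<And>\<mu> v. \<mu> \<in> ext_dual \<Longrightarrow> v \<in> weight_space scaleV \<rho> \<mu> \<Longrightarrow> f v = 0"
  shows "f v = 0"
proof -
  obtain g where g: "Poly_Mapping.keys g \<subseteq> ext_dual"
    "\<And>\<mu>. \<mu> \<in> ext_dual \<Longrightarrow> Poly_Mapping.lookup g \<mu> \<in> weight_space scaleV \<rho> \<mu>"
    "v = (\<Sum>\<mu>\<in>Poly_Mapping.keys g. Poly_Mapping.lookup g \<mu>)"
    using weight_decomposition[of v] by blast
  then show ?thesis using assms by (auto simp: V.endo_sum intro!: sum.neutral)
qed

text \<open>On the component of weight \<open>\<mu>\<close>, \<open>X - c\<close> is the scalar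
  \<open>\<mu> X - c\<close>, whose square annihilates a vector only if the scalar itself does.
  Uniqueness of the decomposition allows the comparison component by component.\<close>

lemma \<hh>_ext_semisimple:
  assumes X: "X \<in> \<hh>_ext"
    and v: "\<rho> X (\<rho> X v - scaleV c v) = scaleV c (\<rho> X v - scaleV c v)"
  shows "\<rho> X v = scaleV c v"
proof -
  note endo = endo_\<rho>[OF \<hh>_ext_LT_ext[OF X]]
  obtain g where g: "Poly_Mapping.keys g \<subseteq> ext_dual"
    "\<And>\<mu>. \<mu> \<in> ext_dual \<Longrightarrow> Poly_Mapping.lookup g \<mu> \<in> weight_space scaleV \<rho> \<mu>"
    "v = (\<Sum>\<mu>\<in>Poly_Mapping.keys g. Poly_Mapping.lookup g \<mu>)"
    using weight_decomposition[of v] by blast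
  let ?g = "\<lambda>r \<mu>. scaleV ((\<mu> X - c) ^ r) (Poly_Mapping.lookup g \<mu>)"
  have gw: "Poly_Mapping.lookup g \<mu> \<in> weight_space scaleV \<rho> \<mu>" if "\<mu> \<in> Poly_Mapping.keys g" for \<mu>
    using g that by blast
  have ab: "scaleV a (scaleV b x) - scaleV c (scaleV a x) = scaleV ((b - c) * a) x" for a b x
    by (simp add: algebra_simps)
  have step: "\<rho> X (\<Sum>\<mu>\<in>Poly_Mapping.keys g. ?g r \<mu>) -
      scaleV c (\<Sum>\<mu>\<in>Poly_Mapping.keys g. ?g r \<mu>) = (\<Sum>\<mu>\<in>Poly_Mapping.keys g. ?g (Suc r) \<mu>)" for r
    unfolding V.endo_sum[OF endo] V.scale_sum_right sum_subtractf[symmetric]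
    by (rule sum.cong) (auto simp: V.endo_scale[OF endo] \<rho>_weight_space[OF X gw] ab
        simp del: V.scale_scale)
  have v1: "\<rho> X v - scaleV c v = (\<Sum>\<mu>\<in>Poly_Mapping.keys g. ?g (Suc 0) \<mu>)"
    using step[of 0] g(3) by simp
  then have sum: "(\<Sum>\<mu>\<in>Poly_Mapping.keys g. ?g (Suc (Suc 0)) \<mu>) = 0"
    using step[of "Suc 0"] v by simp
  have gr: "?g r \<mu> \<in> weight_space scaleV \<rho> \<mu>" if "\<mu> \<in> Poly_Mapping.keys g" for r \<mu>
    using gw[OF that] by (auto simp: weight_space_def V.endo_scale[OF endo_\<rho>[OF \<hh>_ext_LT_ext]] mult.commute)
  have "?g (Suc (Suc 0)) \<mu> = 0" if "\<mu> \<in> Poly_Mapping.keys g" for \<mu>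
    by (rule weight_decomposition_unique[OF finite_keys g(1) gr sum that])
  then have "?g (Suc 0) \<mu> = 0" if "\<mu> \<in> Poly_Mapping.keys g" for \<mu>
    using that by simp
  then have "(\<Sum>\<mu>\<in>Poly_Mapping.keys g. ?g (Suc 0) \<mu>) = 0" by (intro sum.neutral) blast
  then show ?thesis using v1 by simp
qed

lemma L_nilpotent:
  assumes "\<alpha> \<in> dual \<hh>" "\<alpha> \<noteq> (\<lambda>_. 0)" "x \<in> grade_weight \<hh> 0 \<alpha>" "k \<in> \<Gamma>"
  shows "\<exists>N. (L x k ^^ N) v = 0"
  using integrable assms grade_\<Gamma>[OF assms(4)] unfolding integrable_module_def grade_weight_def
  by blast

lemma ideal_grade_0:
  assumes "ideal_of I (grade 0)"
  shows "I = {0} \<or> I = grade 0"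
  using grade_0(2) assms by (auto simp: simple_def)

text \<open>The \<open>x\<close> for which \<open>x(q)\<close> acts by 0 form an ideal that contains
  all brackets, hence all of \<open>grade 0\<close> by simplicity. Then
  \<open>[x(p), y(k - p)]\<close> acts only by its central term, with
  \<open>(x|y) \<noteq> 0\<close> for a suitable choice.\<close>

lemma central_trivial_if_grade_0_trivial:
  assumes triv: "\<And>x v. x \<in> grade 0 \<Longrightarrow> L x 0 v = 0" and k: "k \<in> \<Gamma>" and p: "p \<in> \<Gamma>"
  shows "C (ctr p k) v = 0"
proof -
  have L0: "L x q v = 0" if "x \<in> grade 0" and q: "q \<in> \<Gamma>" for x q v
  proof -
    let ?I = "{x \<in> grade 0. \<forall>v. L x q v = 0}"
    have br: "bracket x y \<in> ?I" if "x \<in> grade 0" "y \<in> grade 0" for x y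
      using L_0_L[OF that q] triv[OF that(1)] endo_L[OF that(2) q] bracket_grade_0[OF that]
      by (simp add: V.endo_0)
    have "ideal_of ?I (grade 0)"
      unfolding ideal_of_def subspace_def using subspace_grade_0 br q
      by (auto simp: L_add L_scale L_zero subspace_add subspace_scale subspace_0)
    moreover obtain x y where "x \<in> grade 0" "y \<in> grade 0" "bracket x y \<noteq> 0"
      using grade_0(2) by (auto simp: simple_def)
    ultimately have "?I = grade 0" using ideal_grade_0 br by blast
    then show ?thesis using that by blast
  qed
  obtain x where x: "x \<in> grade 0" "x \<noteq> 0"
    using grade_0(2) by (auto simp: simple_def) (metis bracket_zero_left)
  obtain y where y: "y \<in> grade 0" "form x y \<noteq> 0"
    using form_nondegenerate_grade_0[OF x] by blast
  have kp: "k - p \<in> \<Gamma>" using k p by (simp add: \<Gamma>_def)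
  have "C (sscale (form x y) (ctr p k)) v = 0"
    using L_L[OF x(1) y(1) p kp, of v] L0 x y bracket_grade_0[OF x(1) y(1)] p k kp by simp
  then show ?thesis using y(2) ctr_\<Z>[OF k] by (simp add: C_scale)
qed

lemma ex_weight_vector:
  "\<exists>\<mu>\<in>ext_dual. \<exists>v\<in>weight_space scaleV \<rho> \<mu>. v \<noteq> 0"
proof (rule ccontr)
  assume "\<not> ?thesis"
  moreover have "V.endo (\<lambda>v. v)" by (simp add: V.endo_iff)
  ultimately have "v = 0" for v :: 'v using eq_0_on_weight_spaces[of "\<lambda>v. v" v] by blast
  then have "(UNIV :: 'v set) = {0}" by auto
  then show False using irreducible by (simp add: irreducible_module_def V.irreducible_under_def)
qed

end

section \<open>Roots and sl2-triples of \<open>grade 0\<close> in the faithful case\<close>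

locale faithful_lie_torus_module = lie_torus_module +
  assumes faithful: "x \<in> grade 0 \<Longrightarrow> (\<And>v. L x 0 v = 0) \<Longrightarrow> x = 0"
begin

lemma L_0_weight_space:
  "h \<in> \<hh> \<Longrightarrow> v \<in> weight_space scaleV \<rho> \<mu> \<Longrightarrow> L h 0 v = scaleV (\<mu> (loop_elem h 0)) v"
  by (rule \<rho>_weight_space[OF loop_elem_\<hh>_ext])

text \<open>Elements of \<open>\<hh>\<close> act by scalars on each weight space, so their bracket
  acts by 0.\<close>

lemma bracket_\<hh>:
  assumes "h \<in> \<hh>" "h' \<in> \<hh>"
  shows "bracket h h' = 0"
proof (rule faithful)
  have g: "h \<in> grade 0" "h' \<in> grade 0" using assms \<hh>_subset by auto
  then show b: "bracket h h' \<in> grade 0" by (rule bracket_grade_0)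
  show "L (bracket h h') 0 v = 0" for v
  proof (rule eq_0_on_weight_spaces[OF endo_L[OF b zero_\<Gamma>]])
    fix \<mu> v assume "v \<in> weight_space scaleV \<rho> \<mu>"
    then show "L (bracket h h') 0 v = 0"
      using L_0_L[OF g zero_\<Gamma>, of v] assms L_0_weight_space endo_L[OF g(1) zero_\<Gamma>]
        endo_L[OF g(2) zero_\<Gamma>]
      by (simp add: V.endo_scale mult.commute)
  qed
qed

text \<open>With \<open>y = [h, x] - c x\<close> and \<open>v\<close> of weight
  \<open>\<mu>\<close>, put \<open>b = \<mu>(h) + c\<close>. Then \<open>h - b\<close> maps
  \<open>x v\<close> to \<open>y v\<close> and \<open>y v\<close> to 0, so \<open>y v = 0\<close>
  because \<open>h\<close> is diagonalizable on the module.\<close>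

lemma ad_\<hh>_semisimple:
  assumes h: "h \<in> \<hh>" and x: "x \<in> grade 0"
    and eq: "bracket h (bracket h x - scale c x) = scale c (bracket h x - scale c x)"
  shows "bracket h x = scale c x"
proof -
  define y where "y = bracket h x - scale c x"
  have hg: "h \<in> grade 0" using h \<hh>_subset by auto
  have y: "y \<in> grade 0"
    unfolding y_def using subspace_grade_0 bracket_grade_0[OF hg x] x
    by (simp add: subspace_diff subspace_scale)
  have hx: "bracket h x = scale c x + y" and hy: "bracket h y = scale c y"
    using eq by (simp_all add: y_def)
  have "L y 0 v = 0" for v
  proof (rule eq_0_on_weight_spaces[OF endo_L[OF y zero_\<Gamma>]])
    fix \<mu> v assume v: "v \<in> weight_space scaleV \<rho> \<mu>"
    define b where "b = \<mu> (loop_elem h 0) + c"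
    have "L h 0 (L x 0 v) = scaleV b (L x 0 v) + L y 0 v"
      using L_0_L[OF hg x zero_\<Gamma>, of v] x y subspace_scale[OF subspace_grade_0 x]
      by (simp add: hx b_def L_0_weight_space[OF h v] V.endo_scale[OF endo_L] L_add L_scale
          zero_\<Gamma> V.scale_left_distrib add.assoc)
    moreover have "L h 0 (L y 0 v) = scaleV b (L y 0 v)"
      using L_0_L[OF hg y zero_\<Gamma>, of v] y
      by (simp add: hy b_def L_0_weight_space[OF h v] V.endo_scale[OF endo_L] L_scale
          zero_\<Gamma> V.scale_left_distrib)
    ultimately show "L y 0 v = 0"
      using \<hh>_ext_semisimple[OF loop_elem_\<hh>_ext[OF h], of "L x 0 v" b] by simp
  qed
  then have "y = 0" by (rule faithful[OF y])
  then show ?thesis by (simp add: y_def)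
qed

text \<open>The adjoint maps of a finite basis of \<open>\<hh>\<close> commute and are
  diagonalizable on \<open>grade 0\<close>; joint eigenvectors for the basis are eigenvectors for
  all of \<open>\<hh>\<close>.\<close>

lemma grade_0_weights: "grade 0 \<subseteq> span {x \<in> grade 0. \<forall>h\<in>\<hh>. \<exists>c. bracket h x = scale c x}"
proof -
  obtain B where B: "B \<subseteq> \<hh>" "independent B" "\<hh> \<subseteq> span B" by (rule basis_exists)
  obtain D where D: "finite D" "span D = UNIV" using fin_dim_UNIV unfolding fin_dim_def by metis
  have "finite B" using independent_span_bound[OF D(1) B(2)] D(2) by auto
  have Bg: "b \<in> grade 0" if "b \<in> B" for b using that B(1) \<hh>_subset by auto
  have "grade 0 \<subseteq> span {x \<in> grade 0. \<forall>f\<in>bracket ` B. \<exists>c. f x = scale c x}"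
  proof (rule G.span_joint_eigenvectors)
    show "finite (bracket ` B)" using \<open>finite B\<close> by simp
    show "f (g x) = g (f x)" if fg: "f \<in> bracket ` B" "g \<in> bracket ` B" and "x \<in> grade 0" for f g x
    proof -
      obtain b b' where b: "b \<in> B" "f = bracket b" "b' \<in> B" "g = bracket b'" using fg by blast
      then have "bracket b b' = 0" using B(1) bracket_\<hh> by blast
      then show ?thesis
        using jacobi[of b b' x] bracket_anticommute[of b' "bracket x b"]
          bracket_anticommute[of x b] b
        by (simp add: G.endo_minus[OF endo_bracket])
    qed
  qed (use Bg B(1) in \<open>auto simp: endo_bracket fin_dim_UNIV subspace_grade_0
        intro: bracket_grade_0 ad_\<hh>_semisimple\<close>)
  also have "\<dots> \<subseteq> span {x \<in> grade 0. \<forall>h\<in>\<hh>. \<exists>c. bracket h x = scale c x}"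
  proof (rule span_mono, safe)
    fix x h assume x: "x \<in> grade 0" "\<forall>f\<in>bracket ` B. \<exists>c. f x = scale c x" and "h \<in> \<hh>"
    from \<open>h \<in> \<hh>\<close> have "h \<in> span B" using B(3) by blast
    then show "\<exists>c. bracket h x = scale c x"
    proof (induction rule: span_induct_alt)
      case base
      show ?case by (rule exI[of _ 0]) simp
    next
      case (step a b y)
      then obtain c c' where "bracket b x = scale c x" "bracket y x = scale c' x" using x by blast
      then show ?case
        by (intro exI[of _ "a * c + c'"])
          (simp add: bracket_add_left bracket_scale_left scale_left_distrib)
    qed
  qed
  finally show ?thesis .
qed

text \<open>Without a non-zero root \<open>\<hh>\<close> would centralize \<open>grade 0\<close>.
  Being self-normalizing, it would contain \<open>grade 0\<close>, which is not abelian.\<close>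

lemma ex_root:
  "\<exists>\<alpha> e. \<alpha> \<in> dual \<hh> \<and> \<alpha> \<noteq> (\<lambda>_. 0) \<and> e \<in> grade_weight \<hh> 0 \<alpha> \<and> e \<noteq> 0"
proof -
  have "\<exists>x\<in>grade 0. (\<forall>h\<in>\<hh>. \<exists>c. bracket h x = scale c x) \<and> (\<exists>h\<in>\<hh>. bracket h x \<noteq> 0)"
  proof (rule ccontr)
    assume "\<not> ?thesis"
    then have "bracket h x = 0" if "h \<in> \<hh>" "x \<in> grade 0" "\<forall>h\<in>\<hh>. \<exists>c. bracket h x = scale c x" for h x
      using that by blast
    then have "span {x \<in> grade 0. \<forall>h\<in>\<hh>. \<exists>c. bracket h x = scale c x} \<subseteq>
        {x. \<forall>h\<in>\<hh>. bracket h x = 0}"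
      by (intro span_minimal) (auto simp: subspace_def bracket_add_right bracket_scale_right)
    then have "bracket x h = 0" if "x \<in> grade 0" "h \<in> \<hh>" for x h
      using grade_0_weights that bracket_anticommute[of x h] by auto
    then have "grade 0 \<subseteq> \<hh>"
      using normalizer_\<hh> subspace_0[OF subspace_\<hh>] by auto
    moreover obtain x y where "x \<in> grade 0" "y \<in> grade 0" "bracket x y \<noteq> 0"
      using grade_0(2) by (auto simp: simple_def)
    ultimately show False using bracket_\<hh> by auto
  qed
  then obtain e h0 where e: "e \<in> grade 0" "\<And>h. h \<in> \<hh> \<Longrightarrow> \<exists>c. bracket h e = scale c e"
    and h0: "h0 \<in> \<hh>" "bracket h0 e \<noteq> 0" by blast
  \<comment> \<open>Set to 0 off \<open>\<hh>\<close>, as \<open>dual \<hh>\<close> demands.\<close>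
  define \<alpha> where "\<alpha> h = (if h \<in> \<hh> then SOME c. bracket h e = scale c e else 0)" for h
  have \<alpha>: "bracket h e = scale (\<alpha> h) e" if "h \<in> \<hh>" for h
    using someI_ex[OF e(2)[OF that]] that by (simp add: \<alpha>_def)
  have "e \<noteq> 0" using h0 by auto
  have "scale (\<alpha> (x + y)) e = scale (\<alpha> x + \<alpha> y) e" if "x \<in> \<hh>" "y \<in> \<hh>" for x y
    using that \<alpha> subspace_add[OF subspace_\<hh>]
    by (simp add: scale_left_distrib bracket_add_left flip: \<alpha>)
  moreover have "scale (\<alpha> (scale c x)) e = scale (c * \<alpha> x) e" if "x \<in> \<hh>" for c x
    using that \<alpha> subspace_scale[OF subspace_\<hh>]
    by (simp add: bracket_scale_left flip: \<alpha> scale_scale)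
  ultimately have "\<alpha> \<in> dual \<hh>" using \<open>e \<noteq> 0\<close> by (auto simp: dual_def \<alpha>_def)
  moreover have "\<alpha> \<noteq> (\<lambda>_. 0)" using h0 \<alpha> by auto
  moreover have "e \<in> grade_weight \<hh> 0 \<alpha>" using e(1) \<alpha> by (simp add: grade_weight_def)
  ultimately show ?thesis using \<open>e \<noteq> 0\<close> by blast
qed

text \<open>The form is non-degenerate on \<open>grade 0\<close>, which weight vectors span, so one
  of them pairs non-trivially with \<open>e\<close>; by invariance its weight is
  \<open>- \<alpha>\<close>.\<close>

lemma ex_opposite_root_vector:
  assumes e: "e \<in> grade_weight \<hh> 0 \<alpha>" "e \<noteq> 0"
  shows "\<exists>f\<in>grade_weight \<hh> 0 (\<lambda>h. - \<alpha> h). form e f \<noteq> 0"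
proof -
  have eg: "e \<in> grade 0" using e(1) by (simp add: grade_weight_def)
  have "\<exists>f\<in>grade 0. (\<forall>h\<in>\<hh>. \<exists>c. bracket h f = scale c f) \<and> form e f \<noteq> 0"
  proof (rule ccontr)
    assume "\<not> ?thesis"
    then have "{x \<in> grade 0. \<forall>h\<in>\<hh>. \<exists>c. bracket h x = scale c x} \<subseteq> {y. form e y = 0}"
      by blast
    moreover have "subspace {y. form e y = 0}"
      by (simp add: subspace_def form_add_right form_scale_right)
    ultimately have "span {x \<in> grade 0. \<forall>h\<in>\<hh>. \<exists>c. bracket h x = scale c x} \<subseteq> {y. form e y = 0}"
      by (rule span_minimal)
    then have "form e y = 0" if "y \<in> grade 0" for y using grade_0_weights that by blast
    then show False using form_nondegenerate_grade_0[OF eg e(2)] by blast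
  qed
  then obtain f where f: "f \<in> grade 0" "\<And>h. h \<in> \<hh> \<Longrightarrow> \<exists>c. bracket h f = scale c f"
    and ef: "form e f \<noteq> 0" by blast
  have "bracket h f = scale (- \<alpha> h) f" if h: "h \<in> \<hh>" for h
  proof -
    obtain c where c: "bracket h f = scale c f" using f(2)[OF h] by blast
    moreover have "bracket h e = scale (\<alpha> h) e" using e h by (simp add: grade_weight_def)
    ultimately have "\<alpha> h + c = 0" using form_weights ef by blast
    then have "c = - \<alpha> h" by (simp add: eq_neg_iff_add_eq_0 add.commute)
    then show ?thesis using c by simp
  qed
  then show ?thesis using f(1) ef by (intro bexI[of _ f]) (auto simp: grade_weight_def)
qed

text \<open>\<open>t = [e, f]\<close> has weight 0, so it normalizes \<open>\<hh>\<close> and lies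
  in it. If \<open>\<alpha>\<close> vanished at \<open>t\<close>, then \<open>t\<close> would act by
  0 and be 0, contradicting \<open>(t|h) = \<alpha>(h) (e|f)\<close> on
  \<open>\<hh>\<close>.\<close>

lemma bracket_opposite_root_vectors:
  assumes \<alpha>: "\<alpha> \<in> dual \<hh>" "\<alpha> \<noteq> (\<lambda>_. 0)"
    and e: "e \<in> grade_weight \<hh> 0 \<alpha>" and f: "f \<in> grade_weight \<hh> 0 (\<lambda>h. - \<alpha> h)"
    and ef: "form e f \<noteq> 0"
  shows "bracket e f \<in> \<hh>" and "\<alpha> (bracket e f) \<noteq> 0"
proof -
  define t where "t = bracket e f"
  have g: "e \<in> grade 0" "f \<in> grade 0" using e f by (auto simp: grade_weight_def)
  have he: "bracket h e = scale (\<alpha> h) e" and hf: "bracket h f = scale (- \<alpha> h) f" if "h \<in> \<hh>" for h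
    using e f that by (auto simp: grade_weight_def)
  have tg: "t \<in> grade 0" unfolding t_def by (rule bracket_grade_0[OF g])
  have "bracket h t = 0" if "h \<in> \<hh>" for h
  proof -
    have "bracket h t + (bracket e (bracket f h) + bracket f (bracket h e)) = 0"
      using jacobi[of h e f] by (simp add: t_def add.assoc)
    then have "bracket h t = - (bracket e (bracket f h) + bracket f (bracket h e))"
      by (simp only: eq_neg_iff_add_eq_0)
    also have "bracket f h = scale (\<alpha> h) f" using hf[OF that] bracket_anticommute[of f h] by simp
    also have "bracket f (bracket h e) = - scale (\<alpha> h) (bracket e f)"
      using he[OF that] bracket_anticommute[of f e] by (simp add: bracket_scale_right)
    finally show ?thesis by (simp add: bracket_scale_right)
  qed
  then have th: "bracket t h = 0" if "h \<in> \<hh>" for h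
    using that bracket_anticommute[of t h] by simp
  then show t\<hh>: "bracket e f \<in> \<hh>"
    using normalizer_\<hh>[OF tg] subspace_0[OF subspace_\<hh>] by (simp add: t_def)
  have form_t: "form t h = \<alpha> h * form e f" if "h \<in> \<hh>" for h
    using hf[OF that] bracket_anticommute[of f h] by (simp add: t_def form_invariant form_scale_right)
  show "\<alpha> (bracket e f) \<noteq> 0"
  proof
    assume "\<alpha> (bracket e f) = 0"
    then have te: "bracket t e = 0" and tf: "bracket t f = 0"
      using he hf t\<hh> by (auto simp: t_def)
    have neg: "(\<lambda>h. - \<alpha> h) \<in> dual \<hh>" "(\<lambda>h. - \<alpha> h) \<noteq> (\<lambda>_. 0)"
      using \<alpha> by (auto simp: dual_def fun_eq_iff)
    \<comment> \<open>Now \<open>e\<close>, \<open>f\<close> and \<open>t\<close> span a Heisenberg algebra, and \<open>t\<close> acts by \<open>0\<close> because \<open>e\<close> and \<open>f\<close>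
      act locally nilpotently.\<close>
    have "L t 0 v = 0" for v
    proof (rule eq_0_on_weight_spaces[OF endo_L[OF tg zero_\<Gamma>]])
      fix \<mu> v assume v: "v \<in> weight_space scaleV \<rho> \<mu>"
      have Tv: "L t 0 v = scaleV (\<mu> (loop_elem t 0)) v"
        using L_0_weight_space v t\<hh> by (simp add: t_def)
      have "\<mu> (loop_elem t 0) = 0" if "v \<noteq> 0"
      proof (rule V.heisenberg_nilpotent[where P = "L e 0" and Q = "L f 0" and T = "L t 0"])
        show "L e 0 (L f 0 x) = L f 0 (L e 0 x) + L t 0 x" for x
          unfolding t_def by (rule L_0_L[OF g zero_\<Gamma>])
        show "L t 0 (L e 0 x) = L e 0 (L t 0 x)" for x
          using L_0_L[OF tg g(1) zero_\<Gamma>] by (simp add: te L_zero zero_\<Gamma>)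
        show "L t 0 (L f 0 x) = L f 0 (L t 0 x)" for x
          using L_0_L[OF tg g(2) zero_\<Gamma>] by (simp add: tf L_zero zero_\<Gamma>)
      qed (use Tv that in \<open>auto intro: endo_L[OF _ zero_\<Gamma>] g
          L_nilpotent[OF \<alpha> e zero_\<Gamma>] L_nilpotent[OF neg f zero_\<Gamma>]\<close>)
      then show "L t 0 v = 0" using Tv by (cases "v = 0") auto
    qed
    then have "t = 0" by (rule faithful[OF tg])
    then have "\<alpha> h = 0" if "h \<in> \<hh>" for h using form_t[OF that] ef by simp
    moreover have "\<alpha> h = 0" if "h \<notin> \<hh>" for h using \<alpha>(1) that by (simp add: dual_def)
    ultimately show False using \<alpha>(2) by blast
  qed
qed

lemma ex_sl2_triple:
  obtains \<alpha> e f h where "\<alpha> \<in> dual \<hh>" "\<alpha> \<noteq> (\<lambda>_. 0)" "e \<in> grade_weight \<hh> 0 \<alpha>"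
    "f \<in> grade_weight \<hh> 0 (\<lambda>h. - \<alpha> h)" "h \<in> \<hh>" "\<alpha> h = 2" "bracket e f = h" "form e f \<noteq> 0"
proof -
  obtain \<alpha> e where \<alpha>: "\<alpha> \<in> dual \<hh>" "\<alpha> \<noteq> (\<lambda>_. 0)" and e: "e \<in> grade_weight \<hh> 0 \<alpha>" "e \<noteq> 0"
    using ex_root by blast
  obtain f where f: "f \<in> grade_weight \<hh> 0 (\<lambda>h. - \<alpha> h)" "form e f \<noteq> 0"
    using ex_opposite_root_vector[OF e] by blast
  note t = bracket_opposite_root_vectors[OF \<alpha> e(1) f]
  define c where "c = 2 / \<alpha> (bracket e f)"
  have "scale c f \<in> grade_weight \<hh> 0 (\<lambda>h. - \<alpha> h)"
    using f(1) subspace_scale[OF subspace_grade_0]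
    by (auto simp: grade_weight_def bracket_scale_right mult.commute)
  moreover have "bracket e (scale c f) \<in> \<hh>"
    using t(1) subspace_scale[OF subspace_\<hh>] by (simp add: bracket_scale_right)
  moreover have "\<alpha> (bracket e (scale c f)) = 2"
    using \<alpha>(1) t by (auto simp: dual_def bracket_scale_right c_def)
  moreover have "form e (scale c f) \<noteq> 0"
    using f(2) t(2) by (simp add: form_scale_right c_def)
  ultimately show thesis using that \<alpha> e(1) by blast
qed

section \<open>The loop algebra of sl2 acting on the module\<close>

lemma weight_shift:
  assumes X: "X \<in> \<hh>_ext" and v: "\<rho> X v = scaleV a v" and x: "x \<in> grade_weight \<hh> 0 \<beta>"
    and k: "k \<in> \<Gamma>"
  shows "\<rho> X (L x k v) =
    scaleV (a + \<beta> (Poly_Mapping.lookup (fst X) 0) + pairing (snd (snd X)) k) (L x k v)"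
proof -
  have xg: "x \<in> grade 0" using x by (simp add: grade_weight_def)
  have xk: "x \<in> grade_weight \<hh> k \<beta>" using x grade_\<Gamma>[OF k] by (simp add: grade_weight_def)
  have "\<rho> X (L x k v) = L x k (\<rho> X v) + \<rho> (ext_bracket X (loop_elem x k)) v"
    using \<rho>_bracket[OF \<hh>_ext_LT_ext[OF X] loop_elem_LT_ext'[OF xg k]] by simp
  also have "\<rho> (ext_bracket X (loop_elem x k)) v =
      scaleV (\<beta> (Poly_Mapping.lookup (fst X) 0) + pairing (snd (snd X)) k) (L x k v)"
    unfolding ext_bracket_weight[OF xk X] by (rule \<rho>_scale[OF loop_elem_LT_ext'[OF xg k]])
  finally show ?thesis
    by (simp add: v V.endo_scale[OF endo_L[OF xg k]] V.scale_left_distrib add.assoc)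
qed

lemma central_trivial:
  "C (ctr (rescale w) (rescale k)) v = 0"
proof -
  obtain \<alpha> e f h where \<alpha>: "\<alpha> \<in> dual \<hh>" "\<alpha> \<noteq> (\<lambda>_. 0)" and e: "e \<in> grade_weight \<hh> 0 \<alpha>"
    and f: "f \<in> grade_weight \<hh> 0 (\<lambda>h. - \<alpha> h)" and h: "h \<in> \<hh>" "\<alpha> h = 2" and ef: "bracket e f = h"
    and \<kappa>: "form e f \<noteq> 0"
    by (rule ex_sl2_triple)
  have g: "e \<in> grade 0" "f \<in> grade 0" "h \<in> grade 0"
    using e f h \<hh>_subset by (auto simp: grade_weight_def)
  have he: "bracket h e = scale 2 e" and hf: "bracket h f = scale (- 2) f"
    using e f h by (auto simp: grade_weight_def)
  \<comment> \<open>The weights 0 and \<open>2\<close> or \<open>- 2\<close> do not cancel; hence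
    \<open>[h(p), e(q)]\<close> and \<open>[h(p), f(q)]\<close> have no central term.\<close>
  have form0: "form h e = 0" "form h f = 0"
    using form_weights[of h h 0 e 2] form_weights[of h h 0 f "- 2"] he hf bracket_self[of h] by auto
  have neg: "(\<lambda>h. - \<alpha> h) \<in> dual \<hh>" "(\<lambda>h. - \<alpha> h) \<noteq> (\<lambda>_. 0)"
    using \<alpha> by (auto simp: dual_def fun_eq_iff)
  obtain \<mu> v0 where \<mu>: "\<mu> \<in> ext_dual" and v0: "v0 \<in> weight_space scaleV \<rho> \<mu>" "v0 \<noteq> 0"
    using ex_weight_vector by blast
  define sh where "sh j q X = (if X \<in> \<hh>_ext then \<mu> X + of_int j * \<alpha> (Poly_Mapping.lookup (fst X) 0) +
    pairing (snd (snd X)) (rescale q) else 0)" for j q X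
  have sh: "sh j q \<in> ext_dual" for j q
    using ext_dual_shift[OF \<mu> \<alpha>(1), of j "rescale q"] by (simp add: sh_def[abs_def])
  note \<Gamma> = rescale_\<Gamma> zero_\<Gamma>
  note \<Z> = ctr_\<Z>[OF rescale_\<Gamma>] scale_\<Z>
  interpret I: integrable_loop_sl2 scaleV "\<lambda>p. L e (rescale p)" "\<lambda>p. L f (rescale p)"
    "\<lambda>p. L h (rescale p)" "\<lambda>p k. C (sscale (form e f) (ctr (rescale p) (rescale k)))"
    "\<lambda>j q. weight_space scaleV \<rho> (sh j q)" "\<mu> (loop_elem h 0)"
  proof unfold_locales
    fix p q k v
    show "L e (rescale p) (L f (rescale q) v) = L f (rescale q) (L e (rescale p) v) +
        L h (rescale (p + q)) v + C (sscale (form e f) (ctr (rescale p) (rescale (p + q)))) v"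
      using L_L[OF g(1,2) \<Gamma>(1) \<Gamma>(1)] by (simp add: ef rescale_add)
    show "L h (rescale p) (L e (rescale q) v) =
        L e (rescale q) (L h (rescale p) v) + scaleV 2 (L e (rescale (p + q)) v)"
      using L_L[OF g(3,1) \<Gamma>(1) \<Gamma>(1)] by (simp add: he form0 rescale_add L_scale g add_\<Gamma> \<Gamma>)
    show "L h (rescale p) (L f (rescale q) v) =
        L f (rescale q) (L h (rescale p) v) - scaleV 2 (L f (rescale (p + q)) v)"
      using L_L[OF g(3,2) \<Gamma>(1) \<Gamma>(1), of p q v] L_scale[OF g(2), of "rescale p + rescale q" "- 2" v]
      by (simp add: hf form0 rescale_add add_\<Gamma> \<Gamma>)
    show "C (sscale (form e f) (ctr (rescale (p + q)) (rescale k))) v =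
        C (sscale (form e f) (ctr (rescale p) (rescale k))) v +
        C (sscale (form e f) (ctr (rescale q) (rescale k))) v"
      by (simp add: rescale_add ctr_add ss.scale_right_distrib C_add \<Z>)
    \<comment> \<open>At total degree 0 the central term is a combination of the
      \<open>K_i\<close>.\<close>
    show "C (sscale (form e f) (ctr (rescale p) (rescale 0))) v = 0"
      unfolding rescale_zero
      by (simp add: ctr_def C_scale C_sum tK_\<Z> zero_\<Gamma> scale_\<Z> K_trivial ctr_\<Z>[OF zero_\<Gamma>, unfolded ctr_def])
    show "\<exists>N. (L e (rescale p) ^^ N) v = 0" by (rule L_nilpotent[OF \<alpha> e \<Gamma>(1)])
    show "\<exists>N. (L f (rescale p) ^^ N) v = 0" by (rule L_nilpotent[OF neg f \<Gamma>(1)])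
  next
    fix j q
    show "V.subspace (weight_space scaleV \<rho> (sh j q))" "V.fin_dim (weight_space scaleV \<rho> (sh j q))"
      using integrable sh unfolding integrable_module_def V.direct_sum_of_def by blast+
  next
    fix p j q v assume v: "v \<in> weight_space scaleV \<rho> (sh j q)"
    show "L e (rescale p) v \<in> weight_space scaleV \<rho> (sh (j + 1) (q + p))"
      using weight_shift[OF _ \<rho>_weight_space[OF _ v] e \<Gamma>(1)]
      by (simp add: weight_space_def sh_def rescale_add pairing_add algebra_simps)
    show "L f (rescale p) v \<in> weight_space scaleV \<rho> (sh (j - 1) (q + p))"
      using weight_shift[OF _ \<rho>_weight_space[OF _ v] f \<Gamma>(1)]
      by (simp add: weight_space_def sh_def rescale_add pairing_add algebra_simps)
    have "Poly_Mapping.lookup (fst (loop_elem h 0)) 0 = h" "snd (snd (loop_elem h 0)) = 0"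
      by (simp_all add: loop_elem_def)
    then show "L h (rescale 0) v = scaleV (\<mu> (loop_elem h 0) + 2 * of_int j) v"
      using L_0_weight_space[OF h(1) v] loop_elem_\<hh>_ext[OF h(1)] by (simp add: sh_def h(2) mult.commute)
  next
    show "\<exists>v\<in>weight_space scaleV \<rho> (sh 0 0). v \<noteq> 0"
      using v0 by (intro bexI[of _ v0]) (auto simp: weight_space_def sh_def)
  qed (auto simp: g \<Gamma> endo_L endo_C \<Z> C_L)
  obtain u where "u \<noteq> 0" "C (sscale (form e f) (ctr (rescale w) (rescale k))) u = 0"
    using I.ex_Z_eq_0 by blast
  then have "C (ctr (rescale w) (rescale k)) u = 0" using \<kappa> by (simp add: C_scale \<Z>)
  with central_zero_or_injective[OF \<Z>(1) sdegree_ctr \<open>u \<noteq> 0\<close>] show ?thesis by blast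
qed

end

section \<open>From homogeneous elements to the whole of \<open>\<Z>\<close>\<close>

context lie_torus_module
begin

text \<open>The kernel of the action of \<open>grade 0\<close> is an ideal, so by simplicity the
  action is faithful or zero.\<close>

lemma ctr_trivial: "C (ctr (rescale w) (rescale k)) v = 0"
proof (cases "\<forall>x\<in>grade 0. (\<forall>v. L x 0 v = 0) \<longrightarrow> x = 0")
  case True
  then interpret faithful_lie_torus_module scale bracket form \<sigma> m \<xi> \<hh> scaleV \<rho>
    by unfold_locales blast
  show ?thesis by (rule central_trivial)
next
  case False
  let ?I = "{x \<in> grade 0. \<forall>v. L x 0 v = 0}"
  have "bracket x y \<in> ?I" if "x \<in> grade 0" "y \<in> ?I" for x y
    using L_0_L[OF that(1) _ zero_\<Gamma>, of y] that endo_L[OF that(1) zero_\<Gamma>]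
    by (auto simp: bracket_grade_0 V.endo_0)
  then have "ideal_of ?I (grade 0)"
    unfolding ideal_of_def subspace_def using subspace_grade_0
    by (auto simp: L_add L_scale L_zero zero_\<Gamma> subspace_add subspace_scale subspace_0)
  then have "?I = grade 0" using ideal_grade_0 False by blast
  then show ?thesis
    by (intro central_trivial_if_grade_0_trivial rescale_\<Gamma>) blast
qed

lemma \<Z>_trivial:
  assumes "z \<in> \<Z>"
  shows "C z v = 0"
proof -
  have tK: "C (tK k i) v = 0" if k: "k \<in> \<Gamma>" for k i
  proof -
    obtain l where l: "k = rescale l" using rescale_surj[OF k] by blast
    \<comment> \<open>For \<open>p\<close> equal to \<open>m i\<close> times the \<open>i\<close>-th
      unit vector, \<open>ctr p k\<close> reduces to the single term \<open>m i\<close> times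
      \<open>tK k i\<close>, and \<open>m i > 0\<close>.\<close>
    have "ctr (rescale (axis i 1)) k = (\<Sum>j\<in>UNIV. if j = i then sscale (of_nat (m i)) (tK k i) else 0)"
      unfolding ctr_def by (rule sum.cong) (auto simp: rescale_def axis_def)
    then have "ctr (rescale (axis i 1)) k = sscale (of_nat (m i)) (tK k i)" by simp
    then have "scaleV (of_nat (m i)) (C (tK k i) v) = 0"
      using ctr_trivial[of "axis i 1" l v] by (simp add: C_scale tK_\<Z>[OF k] flip: l)
    then show ?thesis using \<sigma>_order(1)[of i] by simp
  qed
  have "ss.subspace {z \<in> \<Z>. C z v = 0}"
    by (simp add: ss.subspace_def zero_\<Z> add_\<Z> scale_\<Z> C_add C_scale)
  moreover have "{tK k i | k i. k \<in> \<Gamma>} \<subseteq> {z \<in> \<Z>. C z v = 0}"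
    using tK tK_\<Z> by blast
  ultimately have "ss.span {tK k i | k i. k \<in> \<Gamma>} \<subseteq> {z \<in> \<Z>. C z v = 0}"
    by (intro ss.span_minimal)
  then show ?thesis using assms unfolding \<Z>_def by blast
qed

end

theorem theorem4p9:
  fixes scale :: "complex \<Rightarrow> 'g::ab_group_add \<Rightarrow> 'g"
    and bracket :: "'g \<Rightarrow> 'g \<Rightarrow> 'g"
    and form :: "'g \<Rightarrow> 'g \<Rightarrow> complex"
    and \<sigma> :: "'n::finite \<Rightarrow> 'g \<Rightarrow> 'g"
    and m :: "'n \<Rightarrow> nat"
    and \<xi> :: "'n \<Rightarrow> complex"
    and \<hh> :: "'g set"
    and scaleV :: "complex \<Rightarrow> 'v::ab_group_add \<Rightarrow> 'v"
    and \<rho> :: "(int^'n \<Rightarrow>\<^sub>0 'g) \<times> 'n symbol_space \<times> (complex^'n) \<Rightarrow> 'v \<Rightarrow> 'v"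
  assumes "lie_torus scale bracket form \<sigma> m \<xi> \<hh>"
    and "lie_torus.ext_module scale bracket form \<sigma> m \<xi> scaleV \<rho>"
    and "lie_torus.irreducible_module scale \<sigma> m \<xi> scaleV \<rho>"
    and "lie_torus.integrable_module scale bracket \<sigma> \<xi> \<hh> scaleV \<rho>"
    and "\<forall>i v. \<rho> (lie_torus.central_elem (tK 0 i)) v = 0"
  shows "\<forall>z\<in>lie_torus.\<Z> m. \<forall>v. \<rho> (lie_torus.central_elem z) v = 0"
proof -
  interpret lie_torus scale bracket form \<sigma> m \<xi> \<hh> by (rule assms(1))
  interpret lie_torus_module scale bracket form \<sigma> m \<xi> \<hh> scaleV \<rho>
    by unfold_locales (use assms in auto)
  show ?thesis using \<Z>_trivial by blast
qed

end
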